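(* There is a polynomial-time algorithm which, given a graph $G$ of order $n$, outputs a detection pair of $G$ of size at most $(2\log n+1)\cdot DP(G)$. That is, \textsc{Opt-Detection Pair} can be approximated within a factor $2\log n+1$ on graphs of order $n$.
   Context: All graphs are finite, simple and undirected, and $d(u,v)$ denotes the distance in the graph. A vertex $w$ dominates all vertices of its closed neighbourhood $N[w]$. A vertex $l$ separates vertices $u,v$ if $d(u,l)\neq d(v,l)$. Given $W\subseteq V(G)$ (watchers) and $L\subseteq V(G)$ (listeners), a vertex $u$ is distinguished by $(W,L)$ if either $u$ is dominated by a vertex of $W$, or for every other vertex $v$, either $v$ is dominated by a vertex of $W$ or some vertex of $L$ separates $u$ and $v$. The pair $(W,L)$ (possibly with $W\cap L\neq\emptyset$) is a detection pair of $G$ if every vertex of $G$ is distinguished; its size is $|W|+|L|$, and $DP(G)$ is the minimum size of a detection pair of $G$. Here $\log$ is the natural logarithm. *)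

theory Defs
  imports Complex_Main "Graph_Theory.Graph_Theory" "HOL-Computational_Algebra.Polynomial"
begin

section \<open>Detection pairs\<close>

text \<open>
  A finite simple undirected graph is a \<^locale>\<open>pair_graph\<close>: the arc set is a finite, symmetric,
  loop-free relation on the vertices. The distance is the shortest-path distance for unit weights;
  it is \<open>\<infinity>\<close> between vertices of different components.
\<close>

definition gdist :: "'a pair_pre_digraph \<Rightarrow> 'a \<Rightarrow> 'a \<Rightarrow> ereal" where
  "gdist G u v = wf_digraph.\<mu> (with_proj G) (\<lambda>_. 1) u v"

definition closed_nbhd :: "'a pair_pre_digraph \<Rightarrow> 'a \<Rightarrow> 'a set" where
  "closed_nbhd G w = insert w {u. (w, u) \<in> parcs G}"

definition dominated :: "'a pair_pre_digraph \<Rightarrow> 'a set \<Rightarrow> 'a \<Rightarrow> bool" where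
  "dominated G W u \<longleftrightarrow> (\<exists>w\<in>W. u \<in> closed_nbhd G w)"

definition separates :: "'a pair_pre_digraph \<Rightarrow> 'a \<Rightarrow> 'a \<Rightarrow> 'a \<Rightarrow> bool" where
  "separates G l u v \<longleftrightarrow> gdist G u l \<noteq> gdist G v l"

definition distinguished :: "'a pair_pre_digraph \<Rightarrow> 'a set \<Rightarrow> 'a set \<Rightarrow> 'a \<Rightarrow> bool" where
  "distinguished G W L u \<longleftrightarrow>
     dominated G W u \<or>
     (\<forall>v \<in> pverts G - {u}. dominated G W v \<or> (\<exists>l\<in>L. separates G l u v))"

definition detection_pair :: "'a pair_pre_digraph \<Rightarrow> 'a set \<Rightarrow> 'a set \<Rightarrow> bool" where
  "detection_pair G W L \<longleftrightarrow>
     W \<subseteq> pverts G \<and> L \<subseteq> pverts G \<and> (\<forall>u \<in> pverts G. distinguished G W L u)"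

definition DP :: "'a pair_pre_digraph \<Rightarrow> nat" where
  "DP G = Inf {card W + card L | W L. detection_pair G W L}"

section \<open>Polynomial-time computation\<close>

text \<open>
  The machine model is a unit-cost random access machine with structured control flow, whose memory
  is divided into named arrays of natural numbers (a scalar is an array used at index 0 only).
  The only arithmetic operations are addition and truncated subtraction. As a program is a fixed
  finite object, the expressions evaluated in one step have bounded size, so that after \<open>t\<close> steps
  every number occurring in a run has at most \<open>O(t)\<close> more bits than those of the start state, and the unit
  cost is polynomially related to the running time of a Turing machine. (With unit-cost
  multiplication this would fail.)
\<close>

type_synonym vname = string

datatype aexp = N nat | Read vname aexp | Plus aexp aexp | Minus aexp aexp

datatype bexp = Less aexp aexp | Neg bexp | Conj bexp bexp

datatype com =
    Skip
  | Write vname aexp aexp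
  | Seq com com
  | Cond bexp com com
  | While bexp com

type_synonym state = "vname \<Rightarrow> nat \<Rightarrow> nat"

fun aval :: "aexp \<Rightarrow> state \<Rightarrow> nat" where
  "aval (N k) s = k"
| "aval (Read x i) s = s x (aval i s)"
| "aval (Plus a b) s = aval a s + aval b s"
| "aval (Minus a b) s = aval a s - aval b s"

fun bval :: "bexp \<Rightarrow> state \<Rightarrow> bool" where
  "bval (Less a b) s \<longleftrightarrow> aval a s < aval b s"
| "bval (Neg b) s \<longleftrightarrow> \<not> bval b s"
| "bval (Conj b c) s \<longleftrightarrow> bval b s \<and> bval c s"

text \<open>\<open>exec c s t s'\<close>: started in state \<open>s\<close>, program \<open>c\<close> halts after \<open>t\<close> steps in state \<open>s'\<close>.\<close>

inductive exec :: "com \<Rightarrow> state \<Rightarrow> nat \<Rightarrow> state \<Rightarrow> bool" where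
  Skip: "exec Skip s 1 s"
| Write: "exec (Write x i a) s 1 (s(x := (s x)(aval i s := aval a s)))"
| Seq: "exec c1 s t1 s1 \<Longrightarrow> exec c2 s1 t2 s2 \<Longrightarrow> exec (Seq c1 c2) s (t1 + t2) s2"
| CondTrue: "bval b s \<Longrightarrow> exec c1 s t s' \<Longrightarrow> exec (Cond b c1 c2) s (1 + t) s'"
| CondFalse: "\<not> bval b s \<Longrightarrow> exec c2 s t s' \<Longrightarrow> exec (Cond b c1 c2) s (1 + t) s'"
| WhileFalse: "\<not> bval b s \<Longrightarrow> exec (While b c) s 1 s"
| WhileTrue: "bval b s \<Longrightarrow> exec c s t1 s1 \<Longrightarrow> exec (While b c) s1 t2 s2 \<Longrightarrow>
    exec (While b c) s (1 + t1 + t2) s2"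

lemma exec_deterministic:
  "exec c s t s' \<Longrightarrow> exec c s u s'' \<Longrightarrow> u = t \<and> s'' = s'"
proof (induction arbitrary: u s'' rule: exec.induct)
  case Skip
  then show ?case by cases auto
next
  case Write
  then show ?case by cases auto
next
  case Seq
  from Seq.prems show ?case by cases (use Seq.IH in blast)
next
  case CondTrue
  from CondTrue.prems show ?case by cases (use CondTrue in blast)+
next
  case CondFalse
  from CondFalse.prems show ?case by cases (use CondFalse in blast)+
next
  case WhileFalse
  from WhileFalse.prems show ?case by cases (use WhileFalse in auto)
next
  case WhileTrue
  from WhileTrue.prems show ?case by cases (use WhileTrue in blast)+
qed

definition input_state :: "bool list \<Rightarrow> state" where
  "input_state xs =
     (\<lambda>_ _. 0)(''len'' := (\<lambda>_. 0)(0 := length xs),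
              ''in'' := (\<lambda>i. if i < length xs then of_bool (xs ! i) else 0))"

definition output_of :: "state \<Rightarrow> bool list" where
  "output_of s = map (\<lambda>i. s ''out'' i \<noteq> 0) [0..<s ''outlen'' 0]"

text \<open>
  The output length is charged as well, because a program may announce an output that is longer
  than what it has had time to write.
\<close>

definition poly_time_computable_on :: "bool list set \<Rightarrow> (bool list \<Rightarrow> bool list) \<Rightarrow> bool" where
  "poly_time_computable_on D f \<longleftrightarrow>
     (\<exists>c. \<exists>p :: nat poly. \<forall>x\<in>D. \<exists>t s.
        exec c (input_state x) t s \<and> output_of s = f x \<and>
        t + length (f x) \<le> poly p (length x))"

section \<open>Encoding of graphs and of pairs of vertex sets\<close>

definition graphs_of_order :: "nat \<Rightarrow> nat pair_pre_digraph set" where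
  "graphs_of_order n = {G. pair_graph G \<and> pverts G = {..<n}}"

text \<open>The adjacency matrix, row by row.\<close>

definition encode_graph :: "nat \<Rightarrow> nat pair_pre_digraph \<Rightarrow> bool list" where
  "encode_graph n G = concat (map (\<lambda>i. map (\<lambda>j. (i, j) \<in> parcs G) [0..<n]) [0..<n])"

text \<open>The two characteristic vectors, one after the other.\<close>

definition encode_pair :: "nat \<Rightarrow> nat set \<Rightarrow> nat set \<Rightarrow> bool list" where
  "encode_pair n W L = map (\<lambda>i. i \<in> W) [0..<n] @ map (\<lambda>i. i \<in> L) [0..<n]"

end

theory Submission
  imports Defs
begin

text \<open>Finding a detection pair is a set cover problem. The elements are the ordered pairs of distinct
  vertices; a watcher \<open>w\<close> covers the pairs that meet \<open>N[w]\<close>, and a listener \<open>l\<close> covers the pairs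
  that it separates. The greedy algorithm is a \<open>ln m + 1\<close> approximation for \<open>m\<close> elements, and here
  \<open>m = n (n - 1) \<le> n\<^sup>2\<close>. The greedy bound is a potential argument: if \<open>k\<close> sets suffice, some set
  covers at least \<open>R / k\<close> of the \<open>R\<close> uncovered elements, so that every greedy step
  decreases \<open>k (ln R + 1)\<close> by at least 1.\<close>

section \<open>Time-bounded Hoare triples\<close>

text \<open>The machine only adds and subtracts, and it sees nothing but the adjacency matrix and
  its length \<open>n * n\<close>. Hence the order is recovered by summing odd numbers, row offsets
  are tabulated, and \<open>len\<close> bounds both the distances and the number of greedy rounds.
  Only counting loops occur, so termination and time bounds compose mechanically; the price is that
  surplus rounds must be harmless. For the greedy loop they are: since a cover exists, a round in
  which no candidate gains anything shows that nothing is left to cover. An optimal pair is never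
  computed. It enters the analysis alone, as the parameter \<open>Opt\<close>, and bounds the best
  gain by averaging. In the factor, the 2 comes from the square in the number of pairs, and the + 1
  pays for the purchase that empties the uncovered set, where the logarithm is no longer available.
  Listeners compare distances that may be infinite, so a truncated distance must keep infinity apart
  from every finite value; a truncation at no less than the number of arcs does.\<close>

definition triple :: "(state \<Rightarrow> bool) \<Rightarrow> com \<Rightarrow> nat \<Rightarrow> (state \<Rightarrow> bool) \<Rightarrow> bool" where
  "triple P c T Q \<longleftrightarrow> (\<forall>s. P s \<longrightarrow> (\<exists>t s'. exec c s t s' \<and> t \<le> T \<and> Q s'))"

lemma triple_Seq:
  assumes "triple P c T R" "triple R d U Q"
  shows "triple P (Seq c d) (T + U) Q"
  unfolding triple_def
proof (intro allI impI)
  fix s assume "P s"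
  then obtain t s1 where 1: "exec c s t s1" "t \<le> T" "R s1"
    using assms(1) unfolding triple_def by blast
  then obtain u s2 where 2: "exec d s1 u s2" "u \<le> U" "Q s2"
    using assms(2) unfolding triple_def by blast
  show "\<exists>t s'. exec (Seq c d) s t s' \<and> t \<le> T + U \<and> Q s'"
    using exec.Seq[OF 1(1) 2(1)] 1(2) 2(2,3) by (meson add_mono)
qed

lemma triple_conseq:
  assumes "triple P c T Q" "\<And>s. P' s \<Longrightarrow> P s" "\<And>s. Q s \<Longrightarrow> Q' s" "T \<le> T'"
  shows "triple P' c T' Q'"
  using assms unfolding triple_def by (meson le_trans)

text \<open>Freezes data that a precondition merely asserts to exist, or that a variable of the
  state holds, as logical constants while a command is analysed.\<close>

lemma triple_exI:
  assumes "\<And>x. triple (P x) c T Q"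
  shows "triple (\<lambda>s. \<exists>x. P x s) c T Q"
  using assms unfolding triple_def by blast

lemma triple_Cond:
  assumes "triple (\<lambda>s. P s \<and> bval b s) c T Q" "triple (\<lambda>s. P s \<and> \<not> bval b s) d T Q"
  shows "triple P (Cond b c d) (1 + T) Q"
  unfolding triple_def
proof (intro allI impI)
  fix s assume P: "P s"
  show "\<exists>t s'. exec (Cond b c d) s t s' \<and> t \<le> 1 + T \<and> Q s'"
  proof (cases "bval b s")
    case True
    then obtain t s' where "exec c s t s'" "t \<le> T" "Q s'"
      using assms(1) P unfolding triple_def by blast
    then show ?thesis using exec.CondTrue[of b s c t s' d] True by (meson add_left_mono)
  next
    case False
    then obtain t s' where "exec d s t s'" "t \<le> T" "Q s'"
      using assms(2) P unfolding triple_def by blast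
    then show ?thesis using exec.CondFalse[of b s d t s' c] False by (meson add_left_mono)
  qed
qed

section \<open>Commands without loops, evaluated by simplification\<close>

fun loop_free :: "com \<Rightarrow> bool" where
  "loop_free (Seq c d) \<longleftrightarrow> loop_free c \<and> loop_free d"
| "loop_free (Cond b c d) \<longleftrightarrow> loop_free c \<and> loop_free d"
| "loop_free (While b c) \<longleftrightarrow> False"
| "loop_free _ \<longleftrightarrow> True"

fun effect :: "com \<Rightarrow> state \<Rightarrow> state" where
  "effect (Write x i a) s = s(x := (s x)(aval i s := aval a s))"
| "effect (Seq c d) s = effect d (effect c s)"
| "effect (Cond b c d) s = (if bval b s then effect c s else effect d s)"
| "effect _ s = s"

fun duration :: "com \<Rightarrow> nat" where
  "duration (Seq c d) = duration c + duration d"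
| "duration (Cond b c d) = 1 + max (duration c) (duration d)"
| "duration _ = 1"

lemma exec_loop_free: "loop_free c \<Longrightarrow> \<exists>t. exec c s t (effect c s) \<and> t \<le> duration c"
proof (induction c arbitrary: s)
  case (Seq c d)
  then obtain t u where "exec c s t (effect c s)" "t \<le> duration c"
    "exec d (effect c s) u (effect d (effect c s))" "u \<le> duration d"
    by (meson loop_free.simps(1))
  then show ?case using exec.Seq by fastforce
next
  case (Cond b c d)
  from Cond.prems obtain t u where
    "exec c s t (effect c s)" "t \<le> duration c" "exec d s u (effect d s)" "u \<le> duration d"
    using Cond.IH by (meson loop_free.simps(2))
  then show ?case
    using exec.CondTrue[of b s c t "effect c s" d] exec.CondFalse[of b s d u "effect d s" c]
    by (cases "bval b s") (simp; fastforce)+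
next
  case Skip
  show ?case using exec.Skip by (metis duration.simps(3) effect.simps(4) le_refl)
next
  case (Write x i a)
  show ?case using exec.Write by (metis duration.simps(4) effect.simps(1) le_refl)
qed simp

text \<open>Reduces a triple for straight-line code to an implication between state predicates,
  without any inspection of \<open>exec\<close>.\<close>

lemma triple_loop_free:
  assumes "loop_free c" "\<And>s. P s \<Longrightarrow> Q (effect c s)" "duration c \<le> T"
  shows "triple P c T Q"
  unfolding triple_def using assms exec_loop_free by (meson le_trans)

section \<open>Counting loops\<close>

abbreviation V :: "vname \<Rightarrow> aexp" where
  "V x \<equiv> Read x (N 0)"

abbreviation Assign :: "vname \<Rightarrow> aexp \<Rightarrow> com" where
  "Assign x a \<equiv> Write x (N 0) a"

definition For :: "vname \<Rightarrow> aexp \<Rightarrow> com \<Rightarrow> com" where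
  "For x b c =
     Seq (Assign x (N 0)) (While (Less (V x) b) (Seq c (Assign x (Plus (V x) (N 1)))))"

text \<open>Each round costs the body, one test and one increment; the final 2 is the initialisation
  and the failing test.\<close>

definition for_time :: "nat \<Rightarrow> nat \<Rightarrow> nat" where
  "for_time n T = n * (T + 2) + 2"

text \<open>By \<open>stable\<close> the invariant ignores the counter, so the increment preserves
  it; by \<open>bound\<close> the limit, which is evaluated anew at every test, keeps its
  value.\<close>

lemma triple_For_nat:
  assumes body: "\<And>i. i < n \<Longrightarrow>
      triple (\<lambda>s. I i s \<and> s x 0 = i) c T (\<lambda>s. I (Suc i) s \<and> s x 0 = i)"
    and stable: "\<And>i s f. I i (s(x := f)) = I i s"
    and bound: "\<And>i s. I i s \<Longrightarrow> aval b s = n"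
  shows "triple (I 0) (For x b c) (for_time n T) (I n)"
proof -
  let ?body = "Seq c (Assign x (Plus (V x) (N 1)))"
  let ?loop = "While (Less (V x) b) ?body"
  \<comment> \<open>Induction on the number \<open>k\<close> of rounds that remain.\<close>
  have loop: "\<exists>t s'. exec ?loop s t s' \<and> t \<le> k * (T + 2) + 1 \<and> I n s'"
    if "I i s" "s x 0 = i" "i + k = n" for k i s
    using that
  proof (induction k arbitrary: i s)
    case 0
    then have "\<not> bval (Less (V x) b) s" using bound by simp
    from exec.WhileFalse[OF this] 0 show ?case by fastforce
  next
    case (Suc k)
    then have i: "i < n" by simp
    have b: "bval (Less (V x) b) s" using Suc.prems bound i by simp
    obtain t s1 where 1: "exec c s t s1" "t \<le> T" "I (Suc i) s1" "s1 x 0 = i"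
      using body[OF i] Suc.prems unfolding triple_def by blast
    let ?s2 = "s1(x := (s1 x)(0 := Suc i))"
    have "exec ?body s (t + 1) ?s2"
      using exec.Seq[OF 1(1) exec.Write[of x "N 0" "Plus (V x) (N 1)" s1]] 1(4) by simp
    moreover obtain u s3 where "exec ?loop ?s2 u s3" "u \<le> k * (T + 2) + 1" "I n s3"
      using Suc.IH[of "Suc i" ?s2, OF iffD2[OF stable 1(3)]] Suc.prems(3)
      by (metis add_Suc_shift fun_upd_same)
    ultimately have "exec ?loop s (1 + (t + 1) + u) s3 \<and> I n s3"
      using exec.WhileTrue[OF b] by blast
    moreover have "1 + (t + 1) + u \<le> Suc k * (T + 2) + 1"
      using 1(2) \<open>u \<le> _\<close> by simp
    ultimately show ?case by blast
  qed
  show ?thesis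
    unfolding triple_def For_def
  proof (intro allI impI)
    fix s assume "I 0 s"
    let ?s = "s(x := (s x)(0 := 0))"
    obtain t s' where t: "exec ?loop ?s t s'" "t \<le> n * (T + 2) + 1" "I n s'"
      using loop[of 0 ?s n] \<open>I 0 s\<close> stable by auto
    have "exec (Seq (Assign x (N 0)) ?loop) s (1 + t) s'"
      using exec.Seq[OF exec.Write[of x "N 0" "N 0" s]] t(1) by simp
    then show "\<exists>t s'. exec (Seq (Assign x (N 0)) ?loop) s t s' \<and> t \<le> for_time n T \<and> I n s'"
      using t(2,3) unfolding for_time_def by fastforce
  qed
qed

text \<open>In the following rules the invariant depends on the set of the index tuples already visited,
  so that it need not mention the order of the iteration.\<close>

lemma triple_For:
  assumes "\<And>i. i < n \<Longrightarrow>
      triple (\<lambda>s. I {..<i} s \<and> s x 0 = i) c T (\<lambda>s. I (insert i {..<i}) s \<and> s x 0 = i)"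
    and "\<And>S s f. I S (s(x := f)) = I S s"
    and "\<And>S s. I S s \<Longrightarrow> aval b s = n"
  shows "triple (I {}) (For x b c) (for_time n T) (I {..<n})"
  using triple_For_nat[of n "\<lambda>i. I {..<i}" x c T b] assms by (simp add: lessThan_Suc)

lemma triple_For2:
  assumes body: "\<And>i j S. i < m \<Longrightarrow> j < n \<Longrightarrow> (i, j) \<notin> S \<Longrightarrow>
      triple (\<lambda>s. I S s \<and> s x 0 = i \<and> s y 0 = j) c T
        (\<lambda>s. I (insert (i, j) S) s \<and> s x 0 = i \<and> s y 0 = j)"
    and stable: "\<And>S s f. I S (s(x := f)) = I S s" "\<And>S s f. I S (s(y := f)) = I S s"
    and bound: "\<And>S s. I S s \<Longrightarrow> aval a s = m" "\<And>S s. I S s \<Longrightarrow> aval b s = n"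
    and "x \<noteq> y"
  shows "triple (I {}) (For x a (For y b c)) (for_time m (for_time n T)) (I ({..<m} \<times> {..<n}))"
proof -
  \<comment> \<open>\<open>?J i S\<close> describes the moment when the rows before \<open>i\<close>
    and the part \<open>S\<close> of row \<open>i\<close> have been visited. The current entry is
    then new, which \<open>body\<close> may use, for instance to count.\<close>
  let ?J = "\<lambda>i S. I ({..<i} \<times> {..<n} \<union> {i} \<times> S)"
  have row: "insert i {..<i} \<times> {..<n} = {..<i} \<times> {..<n} \<union> {i} \<times> {..<n}" for i :: nat
    by auto
  have entry: "{..<i} \<times> {..<n} \<union> {i} \<times> insert j {..<j} =
      insert (i, j) ({..<i} \<times> {..<n} \<union> {i} \<times> {..<j})" for i j :: nat
    by auto
  have "triple (\<lambda>s. I ({..<i} \<times> {..<n}) s \<and> s x 0 = i) (For y b c) (for_time n T)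
      (\<lambda>s. I (insert i {..<i} \<times> {..<n}) s \<and> s x 0 = i)" if "i < m" for i
  proof -
    have "triple (\<lambda>s. ?J i {..<j} s \<and> s x 0 = i \<and> s y 0 = j) c T
        (\<lambda>s. ?J i (insert j {..<j}) s \<and> s x 0 = i \<and> s y 0 = j)" if "j < n" for j
      unfolding entry using \<open>i < m\<close> \<open>j < n\<close> by (intro body) auto
    then have "triple (\<lambda>s. ?J i {} s \<and> s x 0 = i) (For y b c) (for_time n T)
        (\<lambda>s. ?J i {..<n} s \<and> s x 0 = i)"
      using stable bound(2) \<open>x \<noteq> y\<close>
      by (intro triple_For[where I = "\<lambda>S s. ?J i S s \<and> s x 0 = i"])
        (simp_all add: conj_assoc, blast)
    then show ?thesis by (simp add: row)
  qed
  then show ?thesis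
    using triple_For[of m "\<lambda>S. I (S \<times> {..<n})" x "For y b c" "for_time n T" a,
        OF _ stable(1) bound(1)] by simp
qed

lemma triple_For3:
  assumes body: "\<And>i j k S. i < l \<Longrightarrow> j < m \<Longrightarrow> k < n \<Longrightarrow>
      triple (\<lambda>s. I S s \<and> s x 0 = i \<and> s y 0 = j \<and> s z 0 = k) d T
        (\<lambda>s. I (insert (i, j, k) S) s \<and> s x 0 = i \<and> s y 0 = j \<and> s z 0 = k)"
    and stable: "\<And>S s f. I S (s(x := f)) = I S s" "\<And>S s f. I S (s(y := f)) = I S s"
      "\<And>S s f. I S (s(z := f)) = I S s"
    and bound: "\<And>S s. I S s \<Longrightarrow> aval a s = l" "\<And>S s. I S s \<Longrightarrow> aval b s = m"
      "\<And>S s. I S s \<Longrightarrow> aval c s = n"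
    and "x \<noteq> y" "x \<noteq> z" "y \<noteq> z"
  shows "triple (I {}) (For x a (For y b (For z c d)))
      (for_time l (for_time m (for_time n T))) (I ({..<l} \<times> {..<m} \<times> {..<n}))"
proof -
  let ?J = "\<lambda>i S. I ({..<i} \<times> {..<m} \<times> {..<n} \<union> {i} \<times> S)"
  have row: "insert i {..<i} \<times> {..<m} \<times> {..<n} =
      {..<i} \<times> {..<m} \<times> {..<n} \<union> {i} \<times> {..<m} \<times> {..<n}" for i :: nat
    by auto
  have entry: "A \<union> {i} \<times> insert (j, k) S = insert (i, j, k) (A \<union> {i} \<times> S)"
    for i j k :: nat and A S
    by auto
  have "triple (\<lambda>s. I ({..<i} \<times> {..<m} \<times> {..<n}) s \<and> s x 0 = i) (For y b (For z c d))
      (for_time m (for_time n T)) (\<lambda>s. I (insert i {..<i} \<times> {..<m} \<times> {..<n}) s \<and> s x 0 = i)"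
    if "i < l" for i
  proof -
    have "triple (\<lambda>s. ?J i S s \<and> s x 0 = i \<and> s y 0 = j \<and> s z 0 = k) d T
        (\<lambda>s. ?J i (insert (j, k) S) s \<and> s x 0 = i \<and> s y 0 = j \<and> s z 0 = k)"
      if "j < m" "k < n" for j k S
      unfolding entry using \<open>i < l\<close> that by (intro body) auto
    then have "triple (\<lambda>s. ?J i {} s \<and> s x 0 = i) (For y b (For z c d))
        (for_time m (for_time n T)) (\<lambda>s. ?J i ({..<m} \<times> {..<n}) s \<and> s x 0 = i)"
      using stable bound(2,3) \<open>x \<noteq> y\<close> \<open>x \<noteq> z\<close> \<open>y \<noteq> z\<close>
      by (intro triple_For2[where I = "\<lambda>S s. ?J i S s \<and> s x 0 = i"])
        (simp_all add: conj_assoc, blast+)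
    then show ?thesis by (simp add: row)
  qed
  then show ?thesis
    using triple_For[of l "\<lambda>S. I (S \<times> {..<m} \<times> {..<n})" x "For y b (For z c d)" _ a,
        OF _ stable(1) bound(1)] by simp
qed

section \<open>The greedy algorithm for set cover\<close>

text \<open>\<open>Opt\<close> may be any cover by indices below \<open>K\<close>; only the
  application takes an optimal one.\<close>

locale set_cover =
  fixes U :: "'b set" and cov :: "nat \<Rightarrow> 'b set" and K :: nat and Opt :: "nat set"
  assumes finite_U: "finite U"
    and Opt_index: "Opt \<subseteq> {..<K}"
    and Opt_cover: "U \<subseteq> (\<Union>j\<in>Opt. cov j)"
begin

text \<open>The number of sets that the greedy algorithm still buys when \<open>R\<close> is uncovered is at most
  \<open>potential R\<close>.\<close>

definition potential :: "'b set \<Rightarrow> real" where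
  "potential R = (if R = {} then 0 else real (card Opt) * (ln (real (card R)) + 1))"

text \<open>The invariant after \<open>r\<close> rounds, with \<open>J\<close> bought and
  \<open>R\<close> uncovered. The disjunction forces \<open>R\<close> to be empty after
  \<open>card U\<close> rounds; the last inequality says that the purchases so far plus the
  potential stay within the budget.\<close>

definition good :: "nat \<Rightarrow> 'b set \<Rightarrow> nat set \<Rightarrow> bool" where
  "good r R J \<longleftrightarrow> R \<subseteq> U \<and> J \<subseteq> {..<K} \<and> U \<subseteq> R \<union> (\<Union>j\<in>J. cov j) \<and>
     (R = {} \<or> card R + r \<le> card U) \<and>
     real (card J) + potential R \<le> real (card Opt) * (ln (real (card U)) + 1)"

text \<open>Averaging without division: \<open>Opt\<close> splits \<open>R\<close> into
  \<open>card Opt\<close> pieces, possibly overlapping, each of size at most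
  \<open>g\<close>.\<close>

lemma best_gain:
  assumes "R \<subseteq> U" "\<And>j. j < K \<Longrightarrow> card (R \<inter> cov j) \<le> g"
  shows "card R \<le> card Opt * g"
proof -
  have fin: "finite R" "finite Opt"
    using assms(1) finite_U Opt_index finite_subset by auto
  have "R = (\<Union>j\<in>Opt. R \<inter> cov j)" using assms(1) Opt_cover by auto
  then have "card R \<le> (\<Sum>j\<in>Opt. card (R \<inter> cov j))"
    using card_UN_le[OF fin(2)] by metis
  also have "\<dots> \<le> (\<Sum>j\<in>Opt. g)" using Opt_index assms(2) by (intro sum_mono) auto
  finally show ?thesis by simp
qed

text \<open>With r uncovered elements and gain g, averaging gives g >= r / k, and ln x <= x - 1
  makes the logarithm drop by at least g / r, hence by at least 1 / k.\<close>

lemma potential_step: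
  assumes "R \<subseteq> U" "R \<inter> cov b \<noteq> {}"
    and max: "\<And>j. j < K \<Longrightarrow> card (R \<inter> cov j) \<le> card (R \<inter> cov b)"
  shows "1 + potential (R - cov b) \<le> potential R"
proof -
  have fin: "finite R" using assms(1) finite_U finite_subset by auto
  let ?k = "real (card Opt)" and ?r = "real (card R)" and ?g = "real (card (R \<inter> cov b))"
  let ?r' = "real (card (R - cov b))"
  have "R \<noteq> {}" using assms(2) by auto
  then have r: "?r \<ge> 1" using fin by (simp add: card_gt_0_iff Suc_leI)
  have le: "?r \<le> ?k * ?g"
    using best_gain[OF assms(1) max] by (metis of_nat_le_iff of_nat_mult)
  then have k: "?k \<ge> 1" using r by (cases "card Opt") auto
  have split: "?r = ?r' + ?g"
    using card_Diff_subset_Int[of R "cov b"] fin card_mono[OF fin, of "R \<inter> cov b"] by simp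
  show ?thesis
  proof (cases "R - cov b = {}")
    case True
    \<comment> \<open>The last purchase: the potential falls from at least k >= 1 to 0, thanks to
      the summand 1 in it.\<close>
    have "1 * 1 \<le> ?k * (ln ?r + 1)" using k r by (intro mult_mono) auto
    then show ?thesis using True \<open>R \<noteq> {}\<close> by (simp add: potential_def)
  next
    case False
    then have r': "?r' > 0" using fin by (simp add: card_gt_0_iff)
    \<comment> \<open>The inequality ln x <= x - 1 at the fraction of elements that stays
      uncovered.\<close>
    have "ln (?r' / ?r) \<le> ?r' / ?r - 1" using r r' by (intro ln_le_minus_one) auto
    also have "\<dots> = - (?g / ?r)" using split r by (simp add: field_simps)
    finally have "?g / ?r \<le> ln ?r - ln ?r'" using r r' by (simp add: ln_div)
    then have "?k * (?g / ?r) \<le> ?k * (ln ?r - ln ?r')" by (intro mult_left_mono) auto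
    moreover have "1 \<le> ?k * (?g / ?r)" using le r by (simp add: field_simps)
    ultimately show ?thesis using False \<open>R \<noteq> {}\<close> by (simp add: potential_def algebra_simps)
  qed
qed

lemma good_init: "good 0 U {}"
  by (auto simp: good_def potential_def)

lemma good_step:
  assumes "good r R J" "b < K" "R \<inter> cov b \<noteq> {}"
    and "\<And>j. j < K \<Longrightarrow> card (R \<inter> cov j) \<le> card (R \<inter> cov b)"
  shows "good (Suc r) (R - cov b) (insert b J)"
proof -
  have R: "R \<subseteq> U" "J \<subseteq> {..<K}" using assms(1) by (auto simp: good_def)
  then have fin: "finite R" "finite J" using finite_U finite_subset by auto
  have "card (R - cov b) < card R"
    using assms(3) fin by (intro psubset_card_mono) auto
  moreover have "card (insert b J) \<le> Suc (card J)" by (rule card_insert_le_m1) auto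
  moreover note potential_step[OF R(1) assms(3,4)]
  ultimately show ?thesis using assms(1-3) by (auto simp: good_def)
qed

text \<open>If nothing gains, averaging with \<open>g = 0\<close> shows that \<open>R\<close> is
  empty, so the round counter may advance freely.\<close>

lemma good_idle:
  assumes "good r R J" "\<And>j. j < K \<Longrightarrow> R \<inter> cov j = {}"
  shows "good (Suc r) R J"
proof -
  have "card R \<le> card Opt * 0" using assms by (intro best_gain) (auto simp: good_def)
  moreover have "finite R" using assms(1) finite_U finite_subset by (auto simp: good_def)
  ultimately have "R = {}" by simp
  then show ?thesis using assms(1) by (simp add: good_def)
qed

lemma good_final:
  assumes "good r R J" "card U \<le> r"
  shows "J \<subseteq> {..<K}" "U \<subseteq> (\<Union>j\<in>J. cov j)"
    "real (card J) \<le> real (card Opt) * (ln (real (card U)) + 1)"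
proof -
  have "finite R" using assms(1) finite_U finite_subset by (auto simp: good_def)
  moreover have "card R = 0" using assms by (auto simp: good_def)
  ultimately have "R = {}" by simp
  then show "J \<subseteq> {..<K}" "U \<subseteq> (\<Union>j\<in>J. cov j)"
    "real (card J) \<le> real (card Opt) * (ln (real (card U)) + 1)"
    using assms(1) by (auto simp: good_def potential_def)
qed

end

section \<open>Distances\<close>

text \<open>Distances beyond the bound \<open>m\<close>, in particular infinite ones, are represented by \<open>Suc m\<close>.\<close>

definition dst :: "nat \<Rightarrow> ('a \<times> 'a) set \<Rightarrow> 'a \<Rightarrow> 'a \<Rightarrow> nat" where
  "dst m E u v = (if \<exists>k\<le>m. (u, v) \<in> E ^^ k then LEAST k. (u, v) \<in> E ^^ k else Suc m)"

lemma dst_le_iff: "k \<le> m \<Longrightarrow> dst m E u v \<le> k \<longleftrightarrow> (\<exists>i\<le>k. (u, v) \<in> E ^^ i)"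
proof
  assume "k \<le> m" "dst m E u v \<le> k"
  then have "\<exists>i. (u, v) \<in> E ^^ i" "(LEAST i. (u, v) \<in> E ^^ i) \<le> k"
    by (auto simp: dst_def split: if_splits)
  then show "\<exists>i\<le>k. (u, v) \<in> E ^^ i" by (meson LeastI_ex)
next
  assume k: "k \<le> m" and "\<exists>i\<le>k. (u, v) \<in> E ^^ i"
  then obtain i where i: "i \<le> k" "(u, v) \<in> E ^^ i" by auto
  then have "(LEAST i. (u, v) \<in> E ^^ i) \<le> i" by (auto intro: Least_le)
  moreover have "\<exists>i\<le>m. (u, v) \<in> E ^^ i" using i k le_trans by blast
  ultimately show "dst m E u v \<le> k" using i(1) by (simp add: dst_def)
qed

lemma dst_le_Suc: "dst m E u v \<le> Suc m"
proof (cases "dst m E u v \<le> m")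
  case False
  then show ?thesis using dst_le_iff[of m m E u v] by (auto simp: dst_def)
qed simp

lemma dst_eq_0_iff: "dst m E u v = 0 \<longleftrightarrow> u = v"
  using dst_le_iff[of 0 m E u v] by auto

lemma dst_le_1_iff: "0 < m \<Longrightarrow> dst m E u v \<le> 1 \<longleftrightarrow> u = v \<or> (u, v) \<in> E"
  using dst_le_iff[of 1 m E u v] by (auto simp: le_Suc_eq)

text \<open>The step of breadth-first search. The last but one vertex of a walk with
  \<open>Suc k\<close> arcs has distance at most \<open>k\<close>; were it smaller, \<open>v\<close>
  would itself be within distance \<open>k\<close>.\<close>

lemma dst_le_Suc_iff:
  assumes "k < m"
  shows "dst m E u v \<le> Suc k \<longleftrightarrow>
    dst m E u v \<le> k \<or> (\<exists>w. dst m E u w = k \<and> (w, v) \<in> E)" (is "?l \<longleftrightarrow> ?a \<or> ?b")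
proof
  assume ?l
  then obtain i where i: "i \<le> Suc k" "(u, v) \<in> E ^^ i" using assms dst_le_iff by (metis Suc_leI)
  show "?a \<or> ?b"
  proof (rule disjCI)
    assume not: "\<not> ?b"
    show ?a
    proof (cases "i \<le> k")
      case True
      then show ?thesis using i assms dst_le_iff by (metis less_imp_le)
    next
      case False
      then obtain w where w: "(u, w) \<in> E ^^ k" "(w, v) \<in> E" using i by (auto simp: le_Suc_eq)
      then have "dst m E u w \<le> k" using assms dst_le_iff[of k m E u w] by auto
      then have "dst m E u w < k" using not w by (auto simp: le_less)
      then obtain j where "k = Suc j" "dst m E u w \<le> j" by (cases k) auto
      then obtain l where "l \<le> j" "(u, w) \<in> E ^^ l" using assms dst_le_iff[of j m E u w] by auto
      then have "Suc l \<le> k" "(u, v) \<in> E ^^ Suc l" using \<open>k = Suc j\<close> w(2) by auto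
      then show ?thesis using assms dst_le_iff[of k m E u v] by (metis less_imp_le)
    qed
  qed
next
  assume "?a \<or> ?b"
  then show ?l
  proof
    assume ?b
    then obtain w where w: "dst m E u w \<le> k" "(w, v) \<in> E" by auto
    then obtain i where "i \<le> k" "(u, w) \<in> E ^^ i" using assms dst_le_iff[of k m E u w] by auto
    then have "Suc i \<le> Suc k" "(u, v) \<in> E ^^ Suc i" using w(2) by auto
    then show ?l using assms dst_le_iff[of "Suc k" m E u v] by (metis Suc_leI)
  qed simp
qed

text \<open>Exchanges lists of arcs for relational powers. The empty walk exists only at a vertex,
  whereas the zeroth power relates every element to itself; hence the hypothesis on
  \<open>u\<close>.\<close>

lemma awalk_length_iff_relpow:
  assumes "pair_graph G" "u \<in> pverts G"
  shows "(\<exists>p. pre_digraph.awalk (with_proj G) u p v \<and> length p = k) \<longleftrightarrow>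
    (u, v) \<in> parcs G ^^ k"
proof -
  interpret pair_graph G by fact
  have wf: "wf_digraph (with_proj G)" by unfold_locales
  have "(x, v) \<in> parcs G ^^ length p" if "pre_digraph.awalk (with_proj G) x p v" for x p
    using that
  proof (induction p arbitrary: x)
    case Nil
    then show ?case by (simp add: wf_digraph.awalk_Nil_iff[OF wf])
  next
    case (Cons e p)
    then have "(x, snd e) \<in> parcs G" "pre_digraph.awalk (with_proj G) (snd e) p v"
      by (simp_all add: wf_digraph.awalk_Cons_iff[OF wf])
    then show ?case using Cons.IH by (metis length_Cons relpow_Suc_I2)
  qed
  moreover have "\<exists>p. pre_digraph.awalk (with_proj G) x p v \<and> length p = k"
    if "(x, v) \<in> parcs G ^^ k" "x \<in> pverts G" for x
    using that
  proof (induction k arbitrary: x)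
    case 0
    then show ?case by (intro exI[of _ "[]"]) (simp add: wf_digraph.awalk_Nil_iff[OF wf])
  next
    case (Suc k)
    from relpow_Suc_D2[OF Suc.prems(1)] obtain w
      where w: "(x, w) \<in> parcs G" "(w, v) \<in> parcs G ^^ k" by auto
    then have "w \<in> pverts G" using arc_snd_in_verts by fastforce
    then obtain p where "pre_digraph.awalk (with_proj G) w p v" "length p = k"
      using Suc.IH w(2) by auto
    then show ?case using w(1)
      by (intro exI[of _ "(x, w) # p"]) (simp add: wf_digraph.awalk_Cons_iff[OF wf])
  qed
  ultimately show ?thesis using assms(2) by metis
qed

text \<open>With unit weights the cost of a walk is its length, so the infimum runs over natural
  numbers: it is attained, or it is empty and equals infinity.\<close>

lemma gdist_eq_Least:
  assumes "pair_graph G" "u \<in> pverts G"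
  shows "gdist G u v = (if \<exists>k. (u, v) \<in> parcs G ^^ k
    then ereal (real (LEAST k. (u, v) \<in> parcs G ^^ k)) else \<infinity>)"
proof -
  interpret pair_graph G by fact
  have wf: "wf_digraph (with_proj G)" by unfold_locales
  have cost: "wf_digraph.awalk_cost (\<lambda>_. 1) p = real (length p)" for p :: "('a \<times> 'a) list"
    by (induction p) (simp_all add: wf_digraph.awalk_cost_def[OF wf])
  have "gdist G u v = (INF p\<in>{p. pre_digraph.awalk (with_proj G) u p v}. ereal (real (length p)))"
    unfolding gdist_def wf_digraph.\<mu>_def[OF wf] cost ..
  also have "\<dots> = (INF k\<in>{k. (u, v) \<in> parcs G ^^ k}. ereal (real k))"
    unfolding awalk_length_iff_relpow[OF assms, symmetric]
    by (rule arg_cong[where f = Inf]) auto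
  also have "\<dots> = (if \<exists>k. (u, v) \<in> parcs G ^^ k
    then ereal (real (LEAST k. (u, v) \<in> parcs G ^^ k)) else \<infinity>)"
  proof (cases "\<exists>k. (u, v) \<in> parcs G ^^ k")
    case True
    have "(INF k\<in>{k. (u, v) \<in> parcs G ^^ k}. ereal (real k)) =
        ereal (real (LEAST k. (u, v) \<in> parcs G ^^ k))"
    proof (intro antisym INF_greatest)
      show "(INF k\<in>{k. (u, v) \<in> parcs G ^^ k}. ereal (real k)) \<le>
          ereal (real (LEAST k. (u, v) \<in> parcs G ^^ k))"
        using LeastI_ex[OF True] by (intro INF_lower) simp
    qed (auto intro: Least_le)
    then show ?thesis using True by simp
  next
    case False
    then show ?thesis by (simp add: top_ereal_def)
  qed
  finally show ?thesis .
qed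

text \<open>A reachable vertex is reachable by at most \<open>card (parcs G)\<close> arcs. So the
  code \<open>Suc m\<close> occurs for infinite distances only, and passing from
  \<open>gdist\<close> to \<open>dst\<close> is injective.\<close>

lemma gdist_eq_iff_dst_eq:
  assumes G: "pair_graph G" and "u \<in> pverts G" "v \<in> pverts G"
    and m: "card (parcs G) \<le> m"
  shows "gdist G u l = gdist G v l \<longleftrightarrow> dst m (parcs G) u l = dst m (parcs G) v l"
proof -
  interpret pair_graph G by fact
  have bounded: "\<exists>i\<le>m. (x, y) \<in> parcs G ^^ i" if "(x, y) \<in> parcs G ^^ k" for x y k
  proof -
    have "(x, y) \<in> (\<Union>n\<in>{n. n \<le> card (parcs G)}. parcs G ^^ n)"
      using that by (rule subsetD[OF relpow_finite_bounded[OF pair_finite_arcs]])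
    then obtain i where "i \<le> card (parcs G)" "(x, y) \<in> parcs G ^^ i"
      by auto
    then show ?thesis using m by (meson le_trans)
  qed
  have "gdist G x l = (if dst m (parcs G) x l = Suc m then \<infinity> else ereal (real (dst m (parcs G) x l)))"
    if x: "x \<in> pverts G" for x
  proof (cases "\<exists>k. (x, l) \<in> parcs G ^^ k")
    case True
    then obtain k where k: "k \<le> m" "(x, l) \<in> parcs G ^^ k" using bounded by metis
    then have "dst m (parcs G) x l = (LEAST k. (x, l) \<in> parcs G ^^ k)"
      unfolding dst_def by (intro if_P) (rule exI[of _ k], simp)
    moreover have "(LEAST k. (x, l) \<in> parcs G ^^ k) \<le> k" using k(2) by (rule Least_le)
    ultimately show ?thesis using gdist_eq_Least[OF G x, of l] True k(1) by auto
  next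
    case False
    then have "dst m (parcs G) x l = Suc m" by (simp add: dst_def)
    then show ?thesis using gdist_eq_Least[OF G x, of l] False by simp
  qed
  then show ?thesis using assms(2,3) by auto
qed

section \<open>Layerwise computation of distances\<close>

text \<open>The distance table in the middle of round \<open>k\<close>, when the triples in
  \<open>S\<close> have been examined. A closed formula in the set \<open>S\<close> makes the order
  of the three inner loops irrelevant.\<close>

definition layered :: "nat \<Rightarrow> ('a \<times> 'a) set \<Rightarrow> nat \<Rightarrow> ('a \<times> 'a \<times> 'a) set \<Rightarrow> 'a \<Rightarrow> 'a \<Rightarrow> nat" where
  "layered m E k S u v =
     (if dst m E u v \<le> k then dst m E u v
      else if \<exists>w. (u, v, w) \<in> S \<and> dst m E u w = k \<and> (w, v) \<in> E then Suc k else Suc m)"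

lemma layered_init: "layered m E 0 {} u v = (if u = v then 0 else Suc m)"
  by (simp add: layered_def dst_eq_0_iff)

lemma layered_last: "layered m E m {} = dst m E"
proof (intro ext)
  show "layered m E m {} u v = dst m E u v" for u v
    using dst_le_Suc[of m E u v] by (auto simp: layered_def)
qed

lemma layered_Suc:
  assumes "k < m" "E \<subseteq> X \<times> X" "u \<in> X" "v \<in> X"
  shows "layered m E k (X \<times> X \<times> X) u v = layered m E (Suc k) {} u v"
proof -
  have "(\<exists>w. (u, v, w) \<in> X \<times> X \<times> X \<and> dst m E u w = k \<and> (w, v) \<in> E) \<longleftrightarrow>
      (\<exists>w. dst m E u w = k \<and> (w, v) \<in> E)"
    using assms(2-4) by auto
  then show ?thesis
    using dst_le_Suc_iff[OF assms(1), of E u v] by (auto simp: layered_def)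
qed

text \<open>The table is read while it is being overwritten. This is safe: an entry not yet final
  holds \<open>Suc k\<close> or \<open>Suc m\<close>, never \<open>k\<close>, so the test for
  \<open>k\<close> sees the true layer.\<close>

lemma layered_insert:
  assumes "k < m"
  shows "layered m E k (insert (u, v, w) S) x y =
    (if x = u \<and> y = v \<and> layered m E k S u w = k \<and> (w, v) \<in> E \<and> k < layered m E k S u v
     then Suc k else layered m E k S x y)"
proof -
  have k: "layered m E k S u w = k \<longleftrightarrow> dst m E u w = k"
    using assms by (auto simp: layered_def)
  show ?thesis
  proof (cases "dst m E x y \<le> k")
    case True
    then show ?thesis by (auto simp: layered_def)
  next
    case False
    then show ?thesis using assms unfolding k by (auto simp: layered_def)
  qed
qed

section \<open>The program\<close>

definition Neq :: "aexp \<Rightarrow> aexp \<Rightarrow> bexp" where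
  "Neq a b = Neg (Conj (Neg (Less a b)) (Neg (Less b a)))"

definition Or :: "bexp \<Rightarrow> bexp \<Rightarrow> bexp" where
  "Or b c = Neg (Conj (Neg b) (Neg c))"

text \<open>The product \<open>i * n\<close> is looked up in a table because the machine cannot
  multiply.\<close>

definition Entry :: "aexp \<Rightarrow> aexp \<Rightarrow> aexp" where
  "Entry i j = Plus (Read ''row'' i) j"

lemma bval_Neq [simp]: "bval (Neq a b) s \<longleftrightarrow> aval a s \<noteq> aval b s"
  by (auto simp: Neq_def)

lemma bval_Or [simp]: "bval (Or b c) s \<longleftrightarrow> bval b s \<or> bval c s"
  by (auto simp: Or_def)

text \<open>Consecutive squares differ by \<open>2 n + 1\<close>.\<close>

definition find_order :: com where
  "find_order =
     For ''i'' (V ''len'')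
       (Cond (Less (V ''q'') (V ''len''))
         (Seq (Assign ''q'' (Plus (V ''q'') (Plus (V ''n'') (Plus (V ''n'') (N 1)))))
              (Assign ''n'' (Plus (V ''n'') (N 1))))
         Skip)"

definition fill_rows :: com where
  "fill_rows =
     For ''i'' (V ''n'')
       (Seq (Write ''row'' (V ''i'') (V ''a'')) (Assign ''a'' (Plus (V ''a'') (V ''n''))))"

text \<open>\<open>len + 1\<close> is the value by which \<open>dst\<close> encodes infinity when
  its bound is \<open>n * n\<close>. The flags in \<open>unc\<close> mark the uncovered
  pairs.\<close>

definition init_arrays :: com where
  "init_arrays =
     For ''u'' (V ''n'') (For ''v'' (V ''n'')
       (Cond (Neq (V ''u'') (V ''v''))
         (Seq (Write ''D'' (Entry (V ''u'') (V ''v'')) (Plus (V ''len'') (N 1)))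
              (Write ''unc'' (Entry (V ''u'') (V ''v'')) (N 1)))
         (Seq (Write ''D'' (Entry (V ''u'') (V ''v'')) (N 0))
              (Write ''unc'' (Entry (V ''u'') (V ''v'')) (N 0)))))"

definition relax :: com where
  "relax =
     Cond (Conj (Neg (Neq (Read ''D'' (Entry (V ''u'') (V ''w''))) (V ''k'')))
       (Conj (Less (N 0) (Read ''in'' (Entry (V ''w'') (V ''v''))))
         (Less (V ''k'') (Read ''D'' (Entry (V ''u'') (V ''v''))))))
       (Write ''D'' (Entry (V ''u'') (V ''v'')) (Plus (V ''k'') (N 1)))
       Skip"

text \<open>Breadth-first search from all sources at once, one layer per value of
  \<open>k\<close>.\<close>

definition compute_distances :: com where
  "compute_distances =
     For ''k'' (V ''len'') (For ''u'' (V ''n'') (For ''v'' (V ''n'') (For ''w'' (V ''n'') relax)))"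

text \<open>The watcher \<open>w\<close> is the candidate \<open>w\<close> and the listener \<open>l\<close> is the candidate \<open>n + l\<close>.\<close>

definition covers :: "aexp \<Rightarrow> bexp" where
  "covers j =
     Or (Conj (Less j (V ''n''))
          (Or (Less (Read ''D'' (Entry j (V ''u''))) (N 2))
              (Less (Read ''D'' (Entry j (V ''v''))) (N 2))))
        (Conj (Neg (Less j (V ''n'')))
          (Neq (Read ''D'' (Entry (V ''u'') (Minus j (V ''n''))))
               (Read ''D'' (Entry (V ''v'') (Minus j (V ''n''))))))"

definition compute_gain :: com where
  "compute_gain =
     Seq (Assign ''g'' (N 0))
       (For ''u'' (V ''n'') (For ''v'' (V ''n'')
         (Cond (Conj (Less (N 0) (Read ''unc'' (Entry (V ''u'') (V ''v'')))) (covers (V ''j'')))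
           (Assign ''g'' (Plus (V ''g'') (N 1)))
           Skip)))"

text \<open>If \<open>h\<close> ends as 0, then \<open>b\<close> holds a stale value;
  \<open>greedy\<close> therefore tests \<open>h\<close> before it selects.\<close>

definition find_best :: com where
  "find_best =
     Seq (Assign ''h'' (N 0))
       (For ''j'' (Plus (V ''n'') (V ''n''))
         (Seq compute_gain
           (Cond (Less (V ''h'') (V ''g''))
             (Seq (Assign ''h'' (V ''g'')) (Assign ''b'' (V ''j'')))
             Skip)))"

definition select :: com where
  "select =
     Seq (Write ''out'' (V ''b'') (N 1))
       (For ''u'' (V ''n'') (For ''v'' (V ''n'')
         (Cond (covers (V ''b'')) (Write ''unc'' (Entry (V ''u'') (V ''v'')) (N 0)) Skip)))"

text \<open>At most \<open>n * n\<close> pairs are to be covered and every purchase covers a new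
  one, so \<open>len\<close> rounds suffice.\<close>

definition greedy :: com where
  "greedy = For ''r'' (V ''len'') (Seq find_best (Cond (Less (N 0) (V ''h'')) select Skip))"

definition program :: com where
  "program =
     Seq find_order (Seq fill_rows (Seq init_arrays (Seq compute_distances
       (Seq greedy (Assign ''outlen'' (Plus (V ''n'') (V ''n'')))))))"

section \<open>Matrices stored row by row\<close>

definition mat :: "(nat \<Rightarrow> nat) \<Rightarrow> nat \<Rightarrow> (nat \<Rightarrow> nat \<Rightarrow> nat) \<Rightarrow> bool" where
  "mat f n F \<longleftrightarrow> (\<forall>u<n. \<forall>v<n. f (u * n + v) = F u v)"

lemma matD: "mat f n F \<Longrightarrow> u < n \<Longrightarrow> v < n \<Longrightarrow> f (u * n + v) = F u v"
  by (simp add: mat_def)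

lemma mat_cong: "mat f n F \<Longrightarrow> (\<And>u v. u < n \<Longrightarrow> v < n \<Longrightarrow> F u v = G u v) \<Longrightarrow> mat f n G"
  by (simp add: mat_def)

text \<open>Row-major addresses never collide, because division by \<open>n\<close> recovers the
  row.\<close>

lemma entry_eq_iff:
  fixes n :: nat
  assumes "v < n" "y < n"
  shows "u * n + v = x * n + y \<longleftrightarrow> u = x \<and> v = y"
proof
  assume eq: "u * n + v = x * n + y"
  have "u = (u * n + v) div n" "x = (x * n + y) div n" using assms by simp_all
  then have "u = x" unfolding eq by simp
  then show "u = x \<and> v = y" using eq by simp
qed simp

lemma mat_upd:
  assumes "mat f n F" "v < n"
    and "\<And>x y. x < n \<Longrightarrow> y < n \<Longrightarrow> G x y = (if x = u \<and> y = v then a else F x y)"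
  shows "mat (f(u * n + v := a)) n G"
  using assms by (auto simp: mat_def entry_eq_iff)

section \<open>Correctness of the program\<close>

text \<open>The program is analysed for any relation below \<open>n\<close>; graphs return when
  covers are translated into detection pairs.\<close>

locale bounded_relation =
  fixes n :: nat and E :: "(nat \<times> nat) set"
  assumes E_subset: "E \<subseteq> {..<n} \<times> {..<n}"
begin

text \<open>The data that remain fixed once prepared; \<open>ready_upd\<close> lets the simplifier
  use them as a frame.\<close>

definition ready :: "state \<Rightarrow> bool" where
  "ready s \<longleftrightarrow> s ''n'' 0 = n \<and> s ''len'' 0 = n * n \<and> (\<forall>u<n. s ''row'' u = u * n) \<and>
     mat (s ''in'') n (\<lambda>u v. of_bool ((u, v) \<in> E))"

lemma ready_upd [simp]:
  "x \<notin> {''n'', ''len'', ''row'', ''in''} \<Longrightarrow> ready (s(x := f)) \<longleftrightarrow> ready s"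
  by (auto simp: ready_def)

lemma readyD:
  assumes "ready s"
  shows "s ''n'' 0 = n" "s ''len'' 0 = n * n" "u < n \<Longrightarrow> s ''row'' u = u * n"
    "u < n \<Longrightarrow> v < n \<Longrightarrow> s ''in'' (u * n + v) = of_bool ((u, v) \<in> E)"
  using assms by (auto simp: ready_def mat_def)

lemma triple_find_order:
  "triple
    (\<lambda>s. s ''n'' 0 = 0 \<and> s ''q'' 0 = 0 \<and> s ''a'' 0 = 0 \<and> s ''len'' 0 = n * n \<and>
      mat (s ''in'') n F \<and> (\<forall>i. s ''out'' i = 0))
    find_order (for_time (n * n) 3)
    (\<lambda>s. s ''n'' 0 = n \<and> s ''a'' 0 = 0 \<and> s ''len'' 0 = n * n \<and> mat (s ''in'') n F \<and>
      (\<forall>i. s ''out'' i = 0))"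
proof -
  \<comment> \<open>From round \<open>n\<close> on the loop idles, hence \<open>min i n\<close>; the
    \<open>n * n\<close> rounds are at least \<open>n\<close>.\<close>
  define I where "I i s \<longleftrightarrow> s ''n'' 0 = min i n \<and> s ''q'' 0 = min i n * min i n \<and> s ''a'' 0 = 0 \<and>
      s ''len'' 0 = n * n \<and> mat (s ''in'') n F \<and> (\<forall>i. s ''out'' i = 0)" for i and s :: state
  have sq: "i * i < n * n \<longleftrightarrow> i < n" for i
    by (metis mult_strict_mono' not_less mult_le_mono zero_le)
  have "triple (I 0) find_order (for_time (n * n) 3) (I (n * n))"
    unfolding find_order_def
  proof (rule triple_For_nat[where I = I])
    fix i
    assume "i < n * n"
    show "triple (\<lambda>s. I i s \<and> s ''i'' 0 = i)
      (Cond (Less (V ''q'') (V ''len''))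
         (Seq (Assign ''q'' (Plus (V ''q'') (Plus (V ''n'') (Plus (V ''n'') (N 1)))))
              (Assign ''n'' (Plus (V ''n'') (N 1))))
         Skip) 3
      (\<lambda>s. I (Suc i) s \<and> s ''i'' 0 = i)"
      by (rule triple_loop_free) (auto simp: I_def sq min_def not_less)
  qed (simp_all add: I_def)
  then show ?thesis
    by (rule triple_conseq) (simp_all add: I_def min_absorb2)
qed

lemma triple_fill_rows:
  "triple
    (\<lambda>s. s ''n'' 0 = n \<and> s ''a'' 0 = 0 \<and> s ''len'' 0 = n * n \<and>
      mat (s ''in'') n (\<lambda>u v. of_bool ((u, v) \<in> E)) \<and> (\<forall>i. s ''out'' i = 0))
    fill_rows (for_time n 2)
    (\<lambda>s. ready s \<and> (\<forall>i. s ''out'' i = 0))"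
proof -
  define I where "I i s \<longleftrightarrow> s ''n'' 0 = n \<and> s ''a'' 0 = i * n \<and> (\<forall>u<i. s ''row'' u = u * n) \<and>
      s ''len'' 0 = n * n \<and> mat (s ''in'') n (\<lambda>u v. of_bool ((u, v) \<in> E)) \<and> (\<forall>i. s ''out'' i = 0)"
    for i and s :: state
  have "triple (I 0) fill_rows (for_time n 2) (I n)"
    unfolding fill_rows_def
  proof (rule triple_For_nat[where I = I])
    fix i
    assume "i < n"
    show "triple (\<lambda>s. I i s \<and> s ''i'' 0 = i)
      (Seq (Write ''row'' (V ''i'') (V ''a'')) (Assign ''a'' (Plus (V ''a'') (V ''n'')))) 2
      (\<lambda>s. I (Suc i) s \<and> s ''i'' 0 = i)"
      by (rule triple_loop_free) (auto simp: I_def)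
  qed (simp_all add: I_def)
  then show ?thesis
    by (rule triple_conseq) (simp_all add: I_def ready_def)
qed

definition initial :: "state \<Rightarrow> bool" where
  "initial s \<longleftrightarrow> mat (s ''unc'') n (\<lambda>u v. of_bool (u \<noteq> v)) \<and> (\<forall>i. s ''out'' i = 0)"

lemma initial_upd [simp]:
  "x \<notin> {''unc'', ''out''} \<Longrightarrow> initial (s(x := f)) \<longleftrightarrow> initial s"
  by (auto simp: initial_def)

lemma triple_init_arrays:
  "triple (\<lambda>s. ready s \<and> (\<forall>i. s ''out'' i = 0))
    init_arrays (for_time n (for_time n 3))
    (\<lambda>s. ready s \<and> initial s \<and> mat (s ''D'') n (layered (n * n) E 0 {}))"
proof -
  define I where "I S s \<longleftrightarrow> ready s \<and> (\<forall>i. s ''out'' i = 0) \<and>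
      (\<forall>u<n. \<forall>v<n. (u, v) \<in> S \<longrightarrow>
        s ''D'' (u * n + v) = (if u = v then 0 else Suc (n * n)) \<and>
        s ''unc'' (u * n + v) = of_bool (u \<noteq> v))"
    for S and s :: state
  have "triple (I {}) init_arrays (for_time n (for_time n 3)) (I ({..<n} \<times> {..<n}))"
    unfolding init_arrays_def
  proof (rule triple_For2[where I = I])
    fix u v S
    assume uv: "u < n" "v < n" "(u, v) \<notin> S"
    show "triple (\<lambda>s. I S s \<and> s ''u'' 0 = u \<and> s ''v'' 0 = v)
      (Cond (Neq (V ''u'') (V ''v''))
         (Seq (Write ''D'' (Entry (V ''u'') (V ''v'')) (Plus (V ''len'') (N 1)))
              (Write ''unc'' (Entry (V ''u'') (V ''v'')) (N 1)))
         (Seq (Write ''D'' (Entry (V ''u'') (V ''v'')) (N 0))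
              (Write ''unc'' (Entry (V ''u'') (V ''v'')) (N 0)))) 3
      (\<lambda>s. I (insert (u, v) S) s \<and> s ''u'' 0 = u \<and> s ''v'' 0 = v)"
      by (rule triple_loop_free)
        (use uv in \<open>auto simp: I_def Entry_def readyD entry_eq_iff\<close>)
  qed (auto simp: I_def dest: readyD(1,2))
  then show ?thesis
    by (rule triple_conseq)
      (auto simp: I_def initial_def mat_def layered_init)
qed

lemma triple_compute_distances:
  "triple (\<lambda>s. ready s \<and> initial s \<and> mat (s ''D'') n (layered (n * n) E 0 {}))
    compute_distances (for_time (n * n) (for_time n (for_time n (for_time n 2))))
    (\<lambda>s. ready s \<and> initial s \<and> mat (s ''D'') n (dst (n * n) E))"
proof -
  define I where "I k S s \<longleftrightarrow> ready s \<and> initial s \<and> mat (s ''D'') n (layered (n * n) E k S)"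
    for k S and s :: state
  have "triple (I 0 {}) compute_distances
      (for_time (n * n) (for_time n (for_time n (for_time n 2)))) (I (n * n) {})"
    unfolding compute_distances_def
  proof (rule triple_For_nat[where I = "\<lambda>k. I k {}"])
    fix k
    assume k: "k < n * n"
    have "triple (\<lambda>s. I k {} s \<and> s ''k'' 0 = k)
      (For ''u'' (V ''n'') (For ''v'' (V ''n'') (For ''w'' (V ''n'') relax)))
      (for_time n (for_time n (for_time n 2)))
      (\<lambda>s. I k ({..<n} \<times> {..<n} \<times> {..<n}) s \<and> s ''k'' 0 = k)"
    proof (rule triple_For3[where I = "\<lambda>S s. I k S s \<and> s ''k'' 0 = k"])
      fix u v w S
      assume uvw: "u < n" "v < n" "w < n"
      show "triple
          (\<lambda>s. (I k S s \<and> s ''k'' 0 = k) \<and> s ''u'' 0 = u \<and> s ''v'' 0 = v \<and> s ''w'' 0 = w) relax 2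
          (\<lambda>s. (I k (insert (u, v, w) S) s \<and> s ''k'' 0 = k) \<and>
            s ''u'' 0 = u \<and> s ''v'' 0 = v \<and> s ''w'' 0 = w)"
        unfolding relax_def
      proof (rule triple_loop_free, goal_cases)
        case (2 s)
        then have s: "ready s" "mat (s ''D'') n (layered (n * n) E k S)"
          by (auto simp: I_def)
        note D = matD[OF s(2)]
        show ?case
        proof (cases "layered (n * n) E k S u w = k \<and> (w, v) \<in> E \<and> k < layered (n * n) E k S u v")
          case True
          have "mat ((s ''D'')(u * n + v := Suc k)) n (layered (n * n) E k (insert (u, v, w) S))"
            using True uvw by (intro mat_upd[OF s(2)]) (auto simp: layered_insert[OF k])
          then show ?thesis using 2 True uvw by (simp add: I_def Entry_def readyD D)
        next
          case False
          have "mat (s ''D'') n (layered (n * n) E k (insert (u, v, w) S))"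
            using False by (intro mat_cong[OF s(2)]) (auto simp: layered_insert[OF k])
          then show ?thesis using 2 False uvw by (auto simp: I_def Entry_def readyD D)
        qed
      qed simp_all
    qed (auto simp: I_def dest: readyD(1,2))
    note run = this
    \<comment> \<open>A completed round is the start of the next one.\<close>
    have step: "mat f n (layered (n * n) E (Suc k) {})"
      if "mat f n (layered (n * n) E k ({..<n} \<times> {..<n} \<times> {..<n}))" for f
      using that by (rule mat_cong) (simp add: layered_Suc[OF k E_subset])
    show "triple (\<lambda>s. I k {} s \<and> s ''k'' 0 = k)
      (For ''u'' (V ''n'') (For ''v'' (V ''n'') (For ''w'' (V ''n'') relax)))
      (for_time n (for_time n (for_time n 2)))
      (\<lambda>s. I (Suc k) {} s \<and> s ''k'' 0 = k)"
      by (rule triple_conseq[OF run]) (simp_all add: I_def step)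
  qed (auto simp: I_def dest: readyD(1,2))
  then show ?thesis
    by (rule triple_conseq) (simp_all add: I_def layered_last)
qed

section \<open>The greedy phase: candidates, gains and selection\<close>

definition cov :: "nat \<Rightarrow> (nat \<times> nat) set" where
  "cov j = (if j < n then {(u, v). dst (n * n) E j u < 2 \<or> dst (n * n) E j v < 2}
     else {(u, v). dst (n * n) E u (j - n) \<noteq> dst (n * n) E v (j - n)})"

text \<open>\<open>R\<close> and \<open>J\<close> are ghost variables that tie the state to the
  abstract greedy algorithm.\<close>

definition core :: "(nat \<times> nat) set \<Rightarrow> nat set \<Rightarrow> state \<Rightarrow> bool" where
  "core R J s \<longleftrightarrow> ready s \<and> mat (s ''D'') n (dst (n * n) E) \<and>
     mat (s ''unc'') n (\<lambda>u v. of_bool ((u, v) \<in> R)) \<and> (\<forall>j<2 * n. s ''out'' j = of_bool (j \<in> J))"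

lemma core_upd [simp]:
  "x \<notin> {''n'', ''len'', ''row'', ''in'', ''D'', ''unc'', ''out''} \<Longrightarrow>
    core R J (s(x := f)) \<longleftrightarrow> core R J s"
  by (auto simp: core_def)

lemma coreD:
  assumes "core R J s"
  shows "s ''n'' 0 = n" "s ''len'' 0 = n * n" "u < n \<Longrightarrow> s ''row'' u = u * n"
    "u < n \<Longrightarrow> v < n \<Longrightarrow> s ''D'' (u * n + v) = dst (n * n) E u v"
    "u < n \<Longrightarrow> v < n \<Longrightarrow> s ''unc'' (u * n + v) = of_bool ((u, v) \<in> R)"
    "j < 2 * n \<Longrightarrow> s ''out'' j = of_bool (j \<in> J)"
  using assms by (auto simp: core_def mat_def readyD)

lemma bval_covers:
  assumes "core R J s" "s ''u'' 0 < n" "s ''v'' 0 < n" "aval j s < 2 * n"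
  shows "bval (covers j) s \<longleftrightarrow> (s ''u'' 0, s ''v'' 0) \<in> cov (aval j s)"
proof (cases "aval j s < n")
  case True
  then show ?thesis using assms by (simp add: covers_def cov_def Entry_def coreD)
next
  case False
  then obtain l where "aval j s = n + l" by (metis le_iff_add not_less)
  then show ?thesis using assms by (simp add: covers_def cov_def Entry_def coreD)
qed

text \<open>The arbitrary predicate \<open>B\<close> is a frame that carries the caller's knowledge
  about \<open>r\<close>, \<open>b\<close> and \<open>h\<close> across the computation.\<close>

lemma triple_compute_gain:
  assumes "j < 2 * n" "R \<subseteq> {..<n} \<times> {..<n}"
  shows "triple (\<lambda>s. core R J s \<and> B (s ''r'' 0) (s ''b'' 0) (s ''h'' 0) \<and> s ''j'' 0 = j)
    compute_gain (1 + for_time n (for_time n 2))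
    (\<lambda>s. core R J s \<and> B (s ''r'' 0) (s ''b'' 0) (s ''h'' 0) \<and> s ''j'' 0 = j \<and>
      s ''g'' 0 = card (R \<inter> cov j))"
proof -
  \<comment> \<open>Finiteness of \<open>S\<close> and the freshness of the visited entry make the
    cardinality grow by exactly one.\<close>
  define I where "I S s \<longleftrightarrow> core R J s \<and> B (s ''r'' 0) (s ''b'' 0) (s ''h'' 0) \<and> s ''j'' 0 = j \<and>
      finite S \<and> s ''g'' 0 = card (S \<inter> (R \<inter> cov j))" for S and s :: state
  have "triple (\<lambda>s. core R J s \<and> B (s ''r'' 0) (s ''b'' 0) (s ''h'' 0) \<and> s ''j'' 0 = j)
    compute_gain (1 + for_time n (for_time n 2)) (I ({..<n} \<times> {..<n}))"
    unfolding compute_gain_def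
  proof (rule triple_Seq[where R = "I {}"])
    show "triple (\<lambda>s. core R J s \<and> B (s ''r'' 0) (s ''b'' 0) (s ''h'' 0) \<and> s ''j'' 0 = j)
        (Assign ''g'' (N 0)) 1 (I {})"
      by (rule triple_loop_free) (simp_all add: I_def)
    show "triple (I {}) (For ''u'' (V ''n'') (For ''v'' (V ''n'')
         (Cond (Conj (Less (N 0) (Read ''unc'' (Entry (V ''u'') (V ''v'')))) (covers (V ''j'')))
           (Assign ''g'' (Plus (V ''g'') (N 1)))
           Skip))) (for_time n (for_time n 2)) (I ({..<n} \<times> {..<n}))"
    proof (rule triple_For2[where I = I])
      fix u v S
      assume uv: "u < n" "v < n" "(u, v) \<notin> S"
      show "triple (\<lambda>s. I S s \<and> s ''u'' 0 = u \<and> s ''v'' 0 = v)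
        (Cond (Conj (Less (N 0) (Read ''unc'' (Entry (V ''u'') (V ''v'')))) (covers (V ''j'')))
           (Assign ''g'' (Plus (V ''g'') (N 1)))
           Skip) 2
        (\<lambda>s. I (insert (u, v) S) s \<and> s ''u'' 0 = u \<and> s ''v'' 0 = v)"
      proof (rule triple_loop_free, goal_cases)
        case (2 s)
        then have core: "core R J s" and "finite S" by (auto simp: I_def)
        have "bval (covers (V ''j'')) s \<longleftrightarrow> (u, v) \<in> cov j"
          using bval_covers[OF core] 2 uv assms(1) by (simp add: I_def)
        moreover have "s ''unc'' (u * n + v) = of_bool ((u, v) \<in> R)"
          using core uv by (simp add: coreD)
        moreover have "s ''row'' u = u * n"
          using core uv by (simp add: coreD)
        ultimately show ?case
          using 2 uv(3) \<open>finite S\<close> by (simp add: I_def Entry_def)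
      qed simp_all
    qed (auto simp: I_def dest: coreD(1))
  qed
  moreover have "({..<n} \<times> {..<n}) \<inter> (R \<inter> cov j) = R \<inter> cov j"
    using assms(2) by auto
  ultimately show ?thesis
    by (elim triple_conseq) (simp_all add: I_def)
qed

lemma triple_find_best:
  assumes "R \<subseteq> {..<n} \<times> {..<n}"
  shows "triple (\<lambda>s. core R J s \<and> s ''r'' 0 = r)
    find_best (1 + for_time (2 * n) (1 + for_time n (for_time n 2) + 3))
    (\<lambda>s. core R J s \<and> s ''r'' 0 = r \<and> (\<forall>j<2 * n. card (R \<inter> cov j) \<le> s ''h'' 0) \<and>
      (0 < s ''h'' 0 \<longrightarrow> s ''b'' 0 < 2 * n \<and> card (R \<inter> cov (s ''b'' 0)) = s ''h'' 0))"
proof -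
  define B where "B S r' b h \<longleftrightarrow> r' = r \<and> (\<forall>j\<in>S. card (R \<inter> cov j) \<le> h) \<and>
      (0 < h \<longrightarrow> b < 2 * n \<and> card (R \<inter> cov b) = h)" for S r' b h
  define I where "I S s \<longleftrightarrow> core R J s \<and> B S (s ''r'' 0) (s ''b'' 0) (s ''h'' 0)"
    for S and s :: state
  have "triple (\<lambda>s. core R J s \<and> s ''r'' 0 = r) find_best
      (1 + for_time (2 * n) (1 + for_time n (for_time n 2) + 3)) (I {..<2 * n})"
    unfolding find_best_def
  proof (rule triple_Seq[where R = "I {}"])
    show "triple (\<lambda>s. core R J s \<and> s ''r'' 0 = r) (Assign ''h'' (N 0)) 1 (I {})"
      by (rule triple_loop_free) (simp_all add: I_def B_def)
    show "triple (I {})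
      (For ''j'' (Plus (V ''n'') (V ''n''))
         (Seq compute_gain
           (Cond (Less (V ''h'') (V ''g''))
             (Seq (Assign ''h'' (V ''g'')) (Assign ''b'' (V ''j'')))
             Skip)))
      (for_time (2 * n) (1 + for_time n (for_time n 2) + 3)) (I {..<2 * n})"
    proof (rule triple_For[where I = I])
      fix j
      assume j: "j < 2 * n"
      have "triple (\<lambda>s. I {..<j} s \<and> s ''j'' 0 = j) compute_gain (1 + for_time n (for_time n 2))
          (\<lambda>s. core R J s \<and> B {..<j} (s ''r'' 0) (s ''b'' 0) (s ''h'' 0) \<and> s ''j'' 0 = j \<and>
            s ''g'' 0 = card (R \<inter> cov j))"
        by (rule triple_conseq[OF triple_compute_gain[OF j assms, of J "B {..<j}"]])
          (auto simp: I_def)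
      moreover have "triple (\<lambda>s. core R J s \<and> B {..<j} (s ''r'' 0) (s ''b'' 0) (s ''h'' 0) \<and>
            s ''j'' 0 = j \<and> s ''g'' 0 = card (R \<inter> cov j))
          (Cond (Less (V ''h'') (V ''g''))
             (Seq (Assign ''h'' (V ''g'')) (Assign ''b'' (V ''j'')))
             Skip) 3
          (\<lambda>s. I (insert j {..<j}) s \<and> s ''j'' 0 = j)"
        by (rule triple_loop_free) (use j in \<open>auto simp: I_def B_def intro: less_imp_le[OF le_less_trans]\<close>)
      ultimately show "triple (\<lambda>s. I {..<j} s \<and> s ''j'' 0 = j)
          (Seq compute_gain
            (Cond (Less (V ''h'') (V ''g''))
             (Seq (Assign ''h'' (V ''g'')) (Assign ''b'' (V ''j'')))
             Skip)) (1 + for_time n (for_time n 2) + 3)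
          (\<lambda>s. I (insert j {..<j}) s \<and> s ''j'' 0 = j)"
        by (rule triple_Seq)
    qed (auto simp: I_def dest: coreD(1))
  qed
  then show ?thesis
    by (rule triple_conseq) (auto simp: I_def B_def)
qed

lemma triple_select:
  assumes "b < 2 * n"
  shows "triple (\<lambda>s. core R J s \<and> s ''r'' 0 = r \<and> s ''b'' 0 = b)
    select (1 + for_time n (for_time n 2))
    (\<lambda>s. core (R - cov b) (insert b J) s \<and> s ''r'' 0 = r)"
proof -
  define I where "I S s \<longleftrightarrow> core (R - S \<inter> cov b) (insert b J) s \<and> s ''r'' 0 = r \<and> s ''b'' 0 = b"
    for S and s :: state
  have "triple (\<lambda>s. core R J s \<and> s ''r'' 0 = r \<and> s ''b'' 0 = b)
    select (1 + for_time n (for_time n 2)) (I ({..<n} \<times> {..<n}))"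
    unfolding select_def
  proof (rule triple_Seq[where R = "I {}"])
    show "triple (\<lambda>s. core R J s \<and> s ''r'' 0 = r \<and> s ''b'' 0 = b) (Write ''out'' (V ''b'') (N 1)) 1 (I {})"
      by (rule triple_loop_free) (auto simp: I_def core_def)
    show "triple (I {}) (For ''u'' (V ''n'') (For ''v'' (V ''n'')
         (Cond (covers (V ''b'')) (Write ''unc'' (Entry (V ''u'') (V ''v'')) (N 0)) Skip)))
      (for_time n (for_time n 2)) (I ({..<n} \<times> {..<n}))"
    proof (rule triple_For2[where I = I])
      fix u v S
      assume uv: "u < n" "v < n" "(u, v) \<notin> S"
      show "triple (\<lambda>s. I S s \<and> s ''u'' 0 = u \<and> s ''v'' 0 = v)
        (Cond (covers (V ''b'')) (Write ''unc'' (Entry (V ''u'') (V ''v'')) (N 0)) Skip) 2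
        (\<lambda>s. I (insert (u, v) S) s \<and> s ''u'' 0 = u \<and> s ''v'' 0 = v)"
      proof (rule triple_loop_free, goal_cases)
        case (2 s)
        let ?R = "R - S \<inter> cov b" and ?R' = "R - insert (u, v) S \<inter> cov b"
        have core: "core ?R (insert b J) s" using 2 by (simp add: I_def)
        then have unc: "mat (s ''unc'') n (\<lambda>x y. of_bool ((x, y) \<in> ?R))" by (simp add: core_def)
        have covers: "bval (covers (V ''b'')) s \<longleftrightarrow> (u, v) \<in> cov b"
          using bval_covers[OF core] 2 uv assms by (simp add: I_def)
        show ?case
        proof (cases "(u, v) \<in> cov b")
          case True
          have "mat ((s ''unc'')(u * n + v := 0)) n (\<lambda>x y. of_bool ((x, y) \<in> ?R'))"
            using uv True by (intro mat_upd[OF unc]) auto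
          then have "core ?R' (insert b J) (s(''unc'' := (s ''unc'')(u * n + v := 0)))"
            using core by (simp add: core_def)
          moreover have "s ''row'' u = u * n"
            using core uv by (simp add: coreD)
          ultimately show ?thesis
            using 2 covers True by (simp add: I_def Entry_def)
        next
          case False
          then have "?R' = ?R" by auto
          then show ?thesis using 2 covers False by (simp add: I_def)
        qed
      qed simp_all
    qed (auto simp: I_def dest: coreD(1))
  qed
  \<comment> \<open>Off the \<open>n\<close> by \<open>n\<close> square the two remainders of
    \<open>R\<close> may differ, but \<open>mat\<close> looks only inside it.\<close>
  then show ?thesis
    by (rule triple_conseq) (auto simp: I_def core_def elim: mat_cong)
qed

end

section \<open>Running time, the greedy loop and the whole program\<close>

definition gain_time :: "nat \<Rightarrow> nat" where
  "gain_time n = 1 + for_time n (for_time n 2)"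

text \<open>Kept outside the locale, so that it depends on \<open>n\<close> alone and can be shown
  to be a polynomial.\<close>

definition program_time :: "nat \<Rightarrow> nat" where
  "program_time n = for_time (n * n) 3 + (for_time n 2 + (for_time n (for_time n 3) +
     (for_time (n * n) (for_time n (for_time n (for_time n 2))) +
      (for_time (n * n) (1 + for_time (2 * n) (gain_time n + 3) + (1 + gain_time n)) + 1))))"

context bounded_relation
begin

definition pairs :: "(nat \<times> nat) set" where
  "pairs = {(u, v). u < n \<and> v < n \<and> u \<noteq> v}"

lemma pairs_subset: "pairs \<subseteq> {..<n} \<times> {..<n}"
  by (auto simp: pairs_def)

lemma card_pairs_le: "card pairs \<le> n * n"
  using card_mono[OF _ pairs_subset] by simp

lemma triple_greedy:
  assumes "set_cover pairs cov (2 * n) Opt"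
  shows "triple (\<lambda>s. ready s \<and> initial s \<and> mat (s ''D'') n (dst (n * n) E))
    greedy (for_time (n * n) (1 + for_time (2 * n) (gain_time n + 3) + (1 + gain_time n)))
    (\<lambda>s. \<exists>R J. set_cover.good pairs cov (2 * n) Opt (n * n) R J \<and> core R J s)"
proof -
  interpret set_cover pairs cov "2 * n" Opt by fact
  define I where "I r s \<longleftrightarrow> (\<exists>R J. good r R J \<and> core R J s)" for r and s :: state
  let ?T = "1 + for_time (2 * n) (gain_time n + 3) + (1 + gain_time n)"
  have "triple (I 0) greedy (for_time (n * n) ?T) (I (n * n))"
    unfolding greedy_def
  proof (rule triple_For_nat[where I = I])
    fix r
    assume "r < n * n"
    let ?Q = "\<lambda>s. I (Suc r) s \<and> s ''r'' 0 = r"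
    let ?P = "\<lambda>R J s. core R J s \<and> s ''r'' 0 = r \<and>
      (\<forall>j<2 * n. card (R \<inter> cov j) \<le> s ''h'' 0) \<and>
      (0 < s ''h'' 0 \<longrightarrow> s ''b'' 0 < 2 * n \<and> card (R \<inter> cov (s ''b'' 0)) = s ''h'' 0)"
    have round: "triple (\<lambda>s. good r R J \<and> core R J s \<and> s ''r'' 0 = r)
        (Seq find_best (Cond (Less (N 0) (V ''h'')) select Skip)) ?T ?Q" for R J
    proof (cases "good r R J")
      case good: True
      then have R: "R \<subseteq> {..<n} \<times> {..<n}"
        using pairs_subset unfolding good_def by blast
      then have fin: "finite R" by (rule finite_subset) simp
      \<comment> \<open>\<open>triple_select\<close> speaks of a fixed index, so the value of the
        variable \<open>b\<close> is frozen here and quantified afterwards.\<close>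
      have chosen: "triple (\<lambda>s. core R J s \<and> s ''r'' 0 = r \<and> s ''b'' 0 = b \<and> b < 2 * n \<and>
          0 < card (R \<inter> cov b) \<and> (\<forall>j<2 * n. card (R \<inter> cov j) \<le> card (R \<inter> cov b)))
          select (gain_time n) ?Q" for b
      proof (cases "b < 2 * n \<and> 0 < card (R \<inter> cov b) \<and>
          (\<forall>j<2 * n. card (R \<inter> cov j) \<le> card (R \<inter> cov b))")
        case True
        then have "good (Suc r) (R - cov b) (insert b J)"
          using good by (intro good_step) auto
        then show ?thesis
          using True
          by (intro triple_conseq[OF triple_select[of b R J r]]) (auto simp: I_def gain_time_def)
      qed (auto simp: triple_def)
      have "triple (?P R J) (Cond (Less (N 0) (V ''h'')) select Skip) (1 + gain_time n) ?Q"
      proof (rule triple_Cond)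
        show "triple (\<lambda>s. ?P R J s \<and> bval (Less (N 0) (V ''h'')) s) select (gain_time n) ?Q"
          by (rule triple_conseq[OF triple_exI[OF chosen]]) auto
        show "triple (\<lambda>s. ?P R J s \<and> \<not> bval (Less (N 0) (V ''h'')) s) Skip (gain_time n) ?Q"
        proof (rule triple_loop_free)
          fix s
          assume s: "?P R J s \<and> \<not> bval (Less (N 0) (V ''h'')) s"
          then have "s ''h'' 0 = 0" by simp
          then have "card (R \<inter> cov j) = 0" if "j < 2 * n" for j
            using s that by (metis le_zero_eq)
          then have "R \<inter> cov j = {}" if "j < 2 * n" for j
            using that fin by simp
          then have "good (Suc r) R J" using good by (intro good_idle) auto
          then show "?Q (effect Skip s)" using s by (auto simp: I_def)
        qed (simp_all add: gain_time_def)
      qed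
      moreover have "triple (\<lambda>s. good r R J \<and> core R J s \<and> s ''r'' 0 = r) find_best
          (1 + for_time (2 * n) (gain_time n + 3)) (?P R J)"
        by (rule triple_conseq[OF triple_find_best[OF R, of J r]]) (simp_all add: gain_time_def)
      ultimately show ?thesis by (rule triple_Seq[rotated])
    qed (simp add: triple_def)
    show "triple (\<lambda>s. I r s \<and> s ''r'' 0 = r)
        (Seq find_best (Cond (Less (N 0) (V ''h'')) select Skip)) ?T ?Q"
      by (rule triple_conseq[OF triple_exI[OF triple_exI[OF round]]]) (auto simp: I_def)
  qed (auto simp: I_def dest: coreD(2))
  then show ?thesis
  proof (rule triple_conseq)
    fix s
    assume s: "ready s \<and> initial s \<and> mat (s ''D'') n (dst (n * n) E)"
    then have "core pairs {} s"
      by (auto simp: core_def initial_def pairs_def elim: mat_cong)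
    then show "I 0 s" using good_init unfolding I_def by blast
  qed (simp_all add: I_def)
qed

lemma triple_program:
  assumes "set_cover pairs cov (2 * n) Opt"
  shows "triple
    (\<lambda>s. s ''n'' 0 = 0 \<and> s ''q'' 0 = 0 \<and> s ''a'' 0 = 0 \<and> s ''len'' 0 = n * n \<and>
      mat (s ''in'') n (\<lambda>u v. of_bool ((u, v) \<in> E)) \<and> (\<forall>i. s ''out'' i = 0))
    program (program_time n)
    (\<lambda>s. \<exists>J\<subseteq>{..<2 * n}. pairs \<subseteq> (\<Union>j\<in>J. cov j) \<and>
      real (card J) \<le> real (card Opt) * (2 * ln (real n) + 1) \<and>
      s ''outlen'' 0 = 2 * n \<and> (\<forall>j<2 * n. s ''out'' j = of_bool (j \<in> J)))"
    (is "triple ?P _ _ ?Q")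
proof -
  interpret set_cover pairs cov "2 * n" Opt by fact
  \<comment> \<open>Without pairs, that is for n <= 1, this rests on \<open>ln 0 = 0\<close>;
    otherwise on \<open>card_pairs_le\<close>.\<close>
  have "ln (real (card pairs)) \<le> 2 * ln (real n)"
  proof (cases "card pairs = 0")
    case True
    then show ?thesis by (cases "n = 0") simp_all
  next
    case False
    then have "real (card pairs) \<le> real n * real n" "n > 0"
      using card_pairs_le by (metis of_nat_le_iff of_nat_mult, cases n) auto
    moreover have "ln (real (card pairs)) \<le> ln (real n * real n)"
      using False calculation by simp
    ultimately show ?thesis by (simp add: ln_mult)
  qed
  then have bound: "real (card Opt) * (ln (real (card pairs)) + 1) \<le>
      real (card Opt) * (2 * ln (real n) + 1)"
    by (intro mult_left_mono) auto
  have "triple (\<lambda>s. \<exists>R J. good (n * n) R J \<and> core R J s)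
      (Assign ''outlen'' (Plus (V ''n'') (V ''n''))) 1 ?Q"
  proof (rule triple_loop_free)
    fix s
    assume "\<exists>R J. good (n * n) R J \<and> core R J s"
    then obtain R J where J: "good (n * n) R J" "core R J s" by blast
    have effect: "effect (Assign ''outlen'' (Plus (V ''n'') (V ''n''))) s =
        s(''outlen'' := (s ''outlen'')(0 := 2 * n))"
      using coreD(1)[OF J(2)] by (simp add: mult_2)
    show "?Q (effect (Assign ''outlen'' (Plus (V ''n'') (V ''n''))) s)"
      unfolding effect
      using good_final[OF J(1) card_pairs_le] coreD(6)[OF J(2)] bound
      by (intro exI[of _ J]) auto
  qed simp_all
  from triple_Seq[OF triple_find_order triple_Seq[OF triple_fill_rows
      triple_Seq[OF triple_init_arrays triple_Seq[OF triple_compute_distances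
      triple_Seq[OF triple_greedy[OF assms] this]]]]]
  show ?thesis unfolding program_def program_time_def .
qed

end

section \<open>Detection pairs as set covers\<close>

lemma graphs_of_orderD:
  assumes "G \<in> graphs_of_order n"
  shows "pair_graph G" "pverts G = {..<n}" "bounded_relation n (parcs G)"
proof -
  show G: "pair_graph G" "pverts G = {..<n}" using assms by (simp_all add: graphs_of_order_def)
  interpret pair_graph G by fact
  show "bounded_relation n (parcs G)"
    using arc_fst_in_verts arc_snd_in_verts G(2) by unfold_locales fastforce
qed

text \<open>In \<open>distinguished\<close> the alternative that \<open>u\<close> is dominated does
  not mention \<open>v\<close> and can be moved under the quantifier over \<open>v\<close>. What
  remains is one condition for each ordered pair of distinct vertices.\<close>

lemma detection_pair_iff_cover:
  assumes G: "G \<in> graphs_of_order n"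
  shows "detection_pair G W L \<longleftrightarrow> W \<subseteq> {..<n} \<and> L \<subseteq> {..<n} \<and>
    bounded_relation.pairs n \<subseteq> (\<Union>j\<in>W \<union> (+) n ` L. bounded_relation.cov n (parcs G) j)"
proof (cases "W \<subseteq> {..<n} \<and> L \<subseteq> {..<n}")
  case True
  interpret bounded_relation n "parcs G" using graphs_of_orderD(3)[OF G] .
  interpret pair_graph G using graphs_of_orderD(1)[OF G] .
  note verts = graphs_of_orderD(2)[OF G]
  have "card (parcs G) \<le> n * n"
    using card_mono[OF _ E_subset] by simp
  note gdist = gdist_eq_iff_dst_eq[OF graphs_of_orderD(1)[OF G] _ _ this, unfolded verts]
  \<comment> \<open>A bound of at least 1 is needed to recognise neighbours; \<open>u < n\<close>
    makes \<open>n * n\<close> positive.\<close>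
  have nbhd: "u \<in> closed_nbhd G w \<longleftrightarrow> dst (n * n) (parcs G) w u < 2" if "u < n" for u w
    using dst_le_1_iff[of "n * n" "parcs G" w u] that by (auto simp: closed_nbhd_def)
  have watcher: "(u, v) \<in> (\<Union>w\<in>W. cov w) \<longleftrightarrow> dominated G W u \<or> dominated G W v"
    if "u < n" "v < n" for u v
    using that True by (auto simp: dominated_def cov_def nbhd)
  have listener: "(u, v) \<in> (\<Union>j\<in>(+) n ` L. cov j) \<longleftrightarrow> (\<exists>l\<in>L. separates G l u v)"
    if "u < n" "v < n" for u v
  proof -
    have "cov (n + l) = {(u, v). dst (n * n) (parcs G) u l \<noteq> dst (n * n) (parcs G) v l}" for l
      by (simp add: cov_def)
    then show ?thesis using that by (simp add: separates_def gdist)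
  qed
  have "(\<forall>u<n. distinguished G W L u) \<longleftrightarrow>
      (\<forall>u v. u < n \<and> v < n \<and> u \<noteq> v \<longrightarrow>
        (dominated G W u \<or> dominated G W v) \<or> (\<exists>l\<in>L. separates G l u v))"
    unfolding distinguished_def verts by auto
  also have "\<dots> \<longleftrightarrow> (\<forall>u v. u < n \<and> v < n \<and> u \<noteq> v \<longrightarrow>
      (u, v) \<in> (\<Union>w\<in>W. cov w) \<or> (u, v) \<in> (\<Union>j\<in>(+) n ` L. cov j))"
    by (simp only: watcher listener cong: imp_cong)
  also have "\<dots> \<longleftrightarrow> pairs \<subseteq> (\<Union>j\<in>W \<union> (+) n ` L. cov j)"
    unfolding UN_Un pairs_def subset_iff
    by (simp only: split_paired_All mem_Collect_eq case_prod_conv Un_iff)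
  finally show ?thesis using True unfolding detection_pair_def verts by (simp add: Ball_def)
qed (auto simp: detection_pair_def graphs_of_orderD(2)[OF G])

text \<open>The shift by \<open>n\<close> keeps the two kinds apart, so a vertex that is both
  watcher and listener counts twice, as it does in the size of a pair.\<close>

lemma card_candidates:
  fixes W L :: "nat set"
  assumes "W \<subseteq> {..<n}" "finite L"
  shows "card (W \<union> (+) n ` L) = card W + card L"
proof -
  have "finite W" "W \<inter> (+) n ` L = {}" using assms(1) finite_subset by fastforce+
  then show ?thesis using assms(2) by (simp add: card_Un_disjoint card_image)
qed

lemma DP_attained:
  assumes G: "G \<in> graphs_of_order n"
  obtains W L where "detection_pair G W L" "card W + card L = DP G"
proof -
  \<comment> \<open>Watching every vertex is a detection pair, so \<open>DP\<close> is an attained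
    minimum and not the infimum of an empty set.\<close>
  have "detection_pair G (pverts G) {}"
    by (auto simp: detection_pair_def distinguished_def dominated_def closed_nbhd_def)
  then have "{card W + card L | W L. detection_pair G W L} \<noteq> {}" by blast
  from Inf_nat_def1[OF this] show thesis
    unfolding DP_def[symmetric] using that by auto
qed

lemma DP_set_cover:
  assumes G: "G \<in> graphs_of_order n"
  obtains Opt where "card Opt = DP G"
    "set_cover (bounded_relation.pairs n) (bounded_relation.cov n (parcs G)) (2 * n) Opt"
proof -
  interpret bounded_relation n "parcs G" using graphs_of_orderD(3)[OF G] .
  obtain W L where WL: "detection_pair G W L" "card W + card L = DP G"
    using DP_attained[OF G] .
  then have sub: "W \<subseteq> {..<n}" "L \<subseteq> {..<n}"
    and cover: "pairs \<subseteq> (\<Union>j\<in>W \<union> (+) n ` L. cov j)"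
    using detection_pair_iff_cover[OF G] by blast+
  have fin: "finite L" "finite pairs"
    using finite_subset[OF sub(2)] finite_subset[OF pairs_subset] by simp_all
  show thesis
  proof
    show "card (W \<union> (+) n ` L) = DP G"
      using card_candidates[OF sub(1) fin(1)] WL(2) by simp
    show "set_cover pairs cov (2 * n) (W \<union> (+) n ` L)"
    proof
      show "W \<union> (+) n ` L \<subseteq> {..<2 * n}" using sub by fastforce
    qed (fact fin(2) cover)+
  qed
qed

section \<open>Encodings and polynomial time bounds\<close>

lemma length_encode_graph: "length (encode_graph n G) = n * n"
  by (simp add: encode_graph_def length_concat o_def sum_list_triv)

lemma nth_concat_rows:
  "u < k \<Longrightarrow> v < n \<Longrightarrow> concat (map (\<lambda>i. map (f i) [0..<n]) [0..<k]) ! (u * n + v) = f u v"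
proof (induction k)
  case (Suc k)
  have len: "length (concat (map (\<lambda>i. map (f i) [0..<n]) [0..<k])) = k * n"
    by (simp add: length_concat o_def sum_list_triv)
  show ?case
  proof (cases "u < k")
    case True
    then have "Suc u * n \<le> k * n" by (intro mult_le_mono1) simp
    then have "u * n + v < k * n" using Suc.prems(2) by simp
    then show ?thesis using Suc True by (simp add: nth_append len)
  next
    case False
    then have "u = k" using Suc.prems by simp
    then show ?thesis using Suc.prems by (simp add: nth_append len)
  qed
qed simp

lemma input_state_encode_graph:
  "mat (input_state (encode_graph n G) ''in'') n (\<lambda>u v. of_bool ((u, v) \<in> parcs G))"
  unfolding mat_def
proof (intro allI impI)
  fix u v
  assume uv: "u < n" "v < n"
  then have "Suc u * n \<le> n * n" by (intro mult_le_mono1) simp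
  then have "u * n + v < n * n" using uv by simp
  then show "input_state (encode_graph n G) ''in'' (u * n + v) = of_bool ((u, v) \<in> parcs G)"
    using uv by (simp add: input_state_def length_encode_graph) (simp add: encode_graph_def nth_concat_rows)
qed

lemma output_of_encode_pair:
  assumes "s ''outlen'' 0 = 2 * n" "\<And>j. j < 2 * n \<Longrightarrow> s ''out'' j = of_bool (j \<in> J)"
  shows "output_of s = encode_pair n (J \<inter> {..<n}) {l. l < n \<and> n + l \<in> J}"
  unfolding output_of_def encode_pair_def assms(1)
  by (rule nth_equalityI) (auto simp: nth_append assms(2))

definition polynomial :: "(nat \<Rightarrow> nat) \<Rightarrow> bool" where
  "polynomial f \<longleftrightarrow> (\<exists>p :: nat poly. \<forall>n. f n = poly p n)"

lemma polynomial_const: "polynomial (\<lambda>n. c)"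
  unfolding polynomial_def by (rule exI[of _ "[:c:]"]) simp

lemma polynomial_id: "polynomial (\<lambda>n. n)"
  unfolding polynomial_def by (rule exI[of _ "[:0, 1:]"]) simp

lemma polynomial_add: "polynomial f \<Longrightarrow> polynomial g \<Longrightarrow> polynomial (\<lambda>n. f n + g n)"
  unfolding polynomial_def by (metis poly_add)

lemma polynomial_mult: "polynomial f \<Longrightarrow> polynomial g \<Longrightarrow> polynomial (\<lambda>n. f n * g n)"
  unfolding polynomial_def by (metis poly_mult)

lemma polynomial_for_time:
  "polynomial f \<Longrightarrow> polynomial g \<Longrightarrow> polynomial (\<lambda>n. for_time (f n) (g n))"
  unfolding for_time_def by (intro polynomial_add polynomial_mult polynomial_const)

text \<open>Lets a bound in the order \<open>n\<close> be weakened to one in the input length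
  \<open>n * n\<close>.\<close>

lemma poly_nat_mono: "m \<le> n \<Longrightarrow> poly p m \<le> poly (p :: nat poly) n"
  by (induction p) (simp_all add: add_mono mult_mono)

text \<open>The summand \<open>2 * n\<close> is the length of the output, which is charged
  too.\<close>

lemma polynomial_program_time: "polynomial (\<lambda>n. program_time n + 2 * n)"
  unfolding program_time_def gain_time_def
  by (intro polynomial_add polynomial_mult polynomial_for_time polynomial_const polynomial_id)

lemma program_correct:
  assumes G: "G \<in> graphs_of_order n"
  shows "\<exists>t s W L. exec program (input_state (encode_graph n G)) t s \<and>
    t \<le> program_time n \<and> output_of s = encode_pair n W L \<and>
    detection_pair G W L \<and> real (card W + card L) \<le> (2 * ln (real n) + 1) * real (DP G)"
proof -
  interpret bounded_relation n "parcs G" using graphs_of_orderD(3)[OF G] .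
  obtain Opt where Opt: "card Opt = DP G" "set_cover pairs cov (2 * n) Opt"
    using DP_set_cover[OF G] .
  let ?s = "input_state (encode_graph n G)"
  have "?s ''n'' 0 = 0 \<and> ?s ''q'' 0 = 0 \<and> ?s ''a'' 0 = 0 \<and> ?s ''len'' 0 = n * n \<and>
      mat (?s ''in'') n (\<lambda>u v. of_bool ((u, v) \<in> parcs G)) \<and> (\<forall>i. ?s ''out'' i = 0)"
    using input_state_encode_graph by (simp add: input_state_def length_encode_graph)
  from triple_program[OF Opt(2), unfolded triple_def Opt(1), rule_format, OF this]
  obtain t s J where ts: "exec program ?s t s" "t \<le> program_time n"
    and J: "J \<subseteq> {..<2 * n}" "pairs \<subseteq> (\<Union>j\<in>J. cov j)"
      "real (card J) \<le> real (DP G) * (2 * ln (real n) + 1)"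
    and out: "s ''outlen'' 0 = 2 * n" "\<forall>j<2 * n. s ''out'' j = of_bool (j \<in> J)"
    by (elim exE conjE) (rule that; assumption)
  let ?W = "J \<inter> {..<n}" and ?L = "{l. l < n \<and> n + l \<in> J}"
  \<comment> \<open>Every chosen index from \<open>n\<close> on is the code \<open>n + l\<close> of
    a listener \<open>l\<close>.\<close>
  have "j \<in> (+) n ` ?L" if "j \<in> J" "\<not> j < n" for j
    using that J(1) by (intro image_eqI[of _ _ "j - n"]) auto
  then have split: "?W \<union> (+) n ` ?L = J" by auto
  have "detection_pair G ?W ?L"
    unfolding detection_pair_iff_cover[OF G] split using J(2) by auto
  moreover have "card ?W + card ?L = card J"
    using card_candidates[of ?W n ?L] split by simp
  moreover have "output_of s = encode_pair n ?W ?L"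
    using out by (intro output_of_encode_pair) auto
  ultimately show ?thesis using ts J(3) by (metis mult.commute)
qed

theorem theorem6:
  shows "\<exists>A :: bool list \<Rightarrow> bool list.
     poly_time_computable_on {encode_graph n G | n G. G \<in> graphs_of_order n} A \<and>
     (\<forall>n. \<forall>G \<in> graphs_of_order n. \<exists>W L.
        A (encode_graph n G) = encode_pair n W L \<and>
        detection_pair G W L \<and>
        real (card W + card L) \<le> (2 * ln (real n) + 1) * real (DP G))"
proof -
  \<comment> \<open>By \<open>exec_deterministic\<close> the choice is the true final state on every
    input on which the program halts.\<close>
  define A where "A x = output_of (SOME s. \<exists>t. exec program (input_state x) t s)" for x
  have A: "A x = output_of s" if "exec program (input_state x) t s" for x t s
  proof -
    have "(SOME s. \<exists>t. exec program (input_state x) t s) = s"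
      using that exec_deterministic by (intro some_equality) blast+
    then show ?thesis by (simp add: A_def)
  qed
  obtain p :: "nat poly" where p: "\<And>n. program_time n + 2 * n = poly p n"
    using polynomial_program_time unfolding polynomial_def by blast
  have "poly_time_computable_on {encode_graph n G | n G. G \<in> graphs_of_order n} A"
    unfolding poly_time_computable_on_def
  proof (intro exI[of _ program] exI[of _ p] ballI)
    fix x
    assume "x \<in> {encode_graph n G | n G. G \<in> graphs_of_order n}"
    then obtain n G where x: "x = encode_graph n G" and G: "G \<in> graphs_of_order n" by blast
    obtain t s W L where run: "exec program (input_state x) t s"
      "t \<le> program_time n" "output_of s = encode_pair n W L"
      using program_correct[OF G] x by blast
    have "length (A x) = 2 * n" unfolding A[OF run(1)] run(3) by (simp add: encode_pair_def)
    then have "t + length (A x) \<le> poly p n" using run(2) p[of n] by linarith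
    also have "\<dots> \<le> poly p (length x)"
      unfolding x length_encode_graph by (rule poly_nat_mono) (rule le_square)
    finally show "\<exists>t s. exec program (input_state x) t s \<and> output_of s = A x \<and>
        t + length (A x) \<le> poly p (length x)"
      using run(1) A by metis
  qed
  moreover have "\<exists>W L. A (encode_graph n G) = encode_pair n W L \<and> detection_pair G W L \<and>
      real (card W + card L) \<le> (2 * ln (real n) + 1) * real (DP G)"
    if "G \<in> graphs_of_order n" for n G
    using program_correct[OF that] A by metis
  ultimately show ?thesis by blast
qed

end
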